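(* Let $G$ be a locally compact group and let $E\subseteq G$ be uniformly discrete. Let $\mathcal U$ be an open neighbourhood of the identity $e$ with $g_1\mathcal U\cap g_2\mathcal U=\emptyset$ for all distinct $g_1,g_2\in E$, let $\mathcal V$ be a symmetric, measurable, relatively compact neighbourhood of $e$ with $\mathcal V^2\subseteq\mathcal U$, let $\xi=1_{\mathcal V}/\|1_{\mathcal V}\|_2\in L^2(G)$, and let $u(x)=\langle\lambda(x)\xi\,|\,\xi\rangle$ for $x\in G$. Define the linear map $\Gamma_u$ on $\ell^2(E)$ by $$\Gamma_u\varphi=\sum_{h\in E}\varphi(h)\,(\delta_h*u),\qquad (\delta_h*u)(x)=u(h^{-1}x).$$ Then: (i) $(\Gamma_u\varphi)|_E=\varphi$ for all $\varphi\in\ell^2(E)$. (ii) $\Gamma_u(\ell^2(E))\subseteq A(G)$, and the map $\Gamma_u:\ell^2(E)\to A(G)$ is a contraction. (iii) $\Gamma_u:\overline{\ell^2(E)_r}\to A(G)$ is a complete contraction.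
   Context: $E\subseteq G$ is uniformly discrete if there is a neighbourhood $\mathcal U$ of $e$ such that $g_1\mathcal U\cap g_2\mathcal U=\emptyset$ for all distinct $g_1,g_2\in E$. $\lambda$ is the left regular representation on $L^2(G)$ (left Haar measure, $\lambda(x)f(y)=f(x^{-1}y)$); inner products are conjugate-linear in the second variable. $A(G)=\{x\mapsto\langle\lambda(x)f\,|\,g\rangle:f,g\in L^2(G)\}$ is the Fourier algebra; it is the predual of the group von Neumann algebra $VN(G)=\overline{\mathrm{span}\{\lambda(x):x\in G\}}^{WOT}$, the function $x\mapsto\langle\lambda(x)f\,|\,g\rangle$ pairing with $T\in VN(G)$ as $\langle Tf\,|\,g\rangle$, and carries the norm and operator space structure of this predual. For a Hilbert space $\mathcal H$, $\mathcal H_r$ is the row operator Hilbert space over $\mathcal H$. For an operator space $X$, $\overline X$ is the complex conjugate space with $\|[\overline{x_{ij}}]\|_{M_n(\overline X)}=\|[x_{ij}]\|_{M_n(X)}$. An element $\overline\varphi\in\overline{\ell^2(E)}$ is identified with the complex-conjugate function $h\mapsto\overline{\varphi(h)}$ in $\ell^2(E)$, and in (iii) $\Gamma_u$ is applied through this linear identification: $\Gamma_u(\overline\varphi)=\sum_{h\in E}\overline{\varphi(h)}\,(\delta_h*u)$. Explicitly, $\|[\overline{\varphi_{ij}}]\|_{M_n(\overline{\ell^2(E)_r})}=\big\|\sum_{h\in E}[\varphi_{ij}(h)][\varphi_{ij}(h)]^*\big\|^{1/2}$. *)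

theory Defs
  imports "HOL-Analysis.Analysis"
begin

text \<open>
  The group \<open>G\<close> is a type of class \<^class>\<open>topological_group_add\<close> (and \<^class>\<open>t2_space\<close>). The operation is
  written additively, as in that class, but it is not assumed to be commutative: \<open>x + y\<close> stands for
  \<open>xy\<close>, \<open>- x\<close> for the inverse of \<open>x\<close>, and \<open>0\<close> for the identity \<open>e\<close>.
\<close>

definition left_haar_measure :: "'a::{topological_group_add, t2_space} measure \<Rightarrow> bool" where
  "left_haar_measure \<mu> \<longleftrightarrow>
     sets \<mu> = sets borel \<and>
     emeasure \<mu> UNIV \<noteq> 0 \<and>
     (\<forall>K. compact K \<longrightarrow> emeasure \<mu> K < \<infinity>) \<and>
     (\<forall>A\<in>sets borel. emeasure \<mu> A = (INF U\<in>{U. open U \<and> A \<subseteq> U}. emeasure \<mu> U)) \<and>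
     (\<forall>U. open U \<longrightarrow> emeasure \<mu> U = (SUP K\<in>{K. compact K \<and> K \<subseteq> U}. emeasure \<mu> K)) \<and>
     (\<forall>x. \<forall>A\<in>sets borel. emeasure \<mu> ((\<lambda>y. x + y) ` A) = emeasure \<mu> A)"

definition uniformly_discrete :: "'a::topological_group_add set \<Rightarrow> bool" where
  "uniformly_discrete E \<longleftrightarrow>
     (\<exists>U. 0 \<in> interior U \<and>
        (\<forall>g1\<in>E. \<forall>g2\<in>E. g1 \<noteq> g2 \<longrightarrow> (\<lambda>y. g1 + y) ` U \<inter> (\<lambda>y. g2 + y) ` U = {}))"


section \<open>\<open>L\<^sup>2(G)\<close> and its bounded operators\<close>

text \<open>
  Elements of \<open>L\<^sup>2(G)\<close> are represented by square integrable functions. The Hilbert space is the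
  quotient by equality almost everywhere, and all notions below depend only on the classes of the
  functions. A bounded operator on \<open>L\<^sup>2(G)\<close> is represented by a map on functions that is linear up
  to null sets and bounded for the seminorm (hence respects equality almost everywhere).
  Norms are real suprema; for elements of the spaces concerned they range over bounded sets.
\<close>

definition L2 :: "'a measure \<Rightarrow> ('a \<Rightarrow> complex) set" where
  "L2 \<mu> = {f \<in> borel_measurable \<mu>. integrable \<mu> (\<lambda>x. (cmod (f x))\<^sup>2)}"

definition L2_inner :: "'a measure \<Rightarrow> ('a \<Rightarrow> complex) \<Rightarrow> ('a \<Rightarrow> complex) \<Rightarrow> complex" where
  "L2_inner \<mu> f g = (\<integral>x. f x * cnj (g x) \<partial>\<mu>)"

definition L2_norm :: "'a measure \<Rightarrow> ('a \<Rightarrow> complex) \<Rightarrow> real" where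
  "L2_norm \<mu> f = sqrt (\<integral>x. (cmod (f x))\<^sup>2 \<partial>\<mu>)"

type_synonym 'a operator = "('a \<Rightarrow> complex) \<Rightarrow> ('a \<Rightarrow> complex)"

definition bounded_operators :: "'a measure \<Rightarrow> 'a operator set" where
  "bounded_operators \<mu> =
     {T. (\<forall>f\<in>L2 \<mu>. T f \<in> L2 \<mu>) \<and>
         (\<forall>f\<in>L2 \<mu>. \<forall>g\<in>L2 \<mu>. AE x in \<mu>. T (\<lambda>y. f y + g y) x = T f x + T g x) \<and>
         (\<forall>c. \<forall>f\<in>L2 \<mu>. AE x in \<mu>. T (\<lambda>y. c * f y) x = c * T f x) \<and>
         (\<exists>C. \<forall>f\<in>L2 \<mu>. L2_norm \<mu> (T f) \<le> C * L2_norm \<mu> f)}"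

definition operator_norm :: "'a measure \<Rightarrow> 'a operator \<Rightarrow> real" where
  "operator_norm \<mu> T = (SUP f\<in>{f \<in> L2 \<mu>. L2_norm \<mu> f \<le> 1}. L2_norm \<mu> (T f))"

text \<open>The norm of \<open>[T k l]\<close>, \<open>k, l < m\<close>, as an operator on the \<open>m\<close>-fold direct sum of \<open>L\<^sup>2(G)\<close>.\<close>

definition operator_matrix_norm :: "'a measure \<Rightarrow> nat \<Rightarrow> (nat \<Rightarrow> nat \<Rightarrow> 'a operator) \<Rightarrow> real" where
  "operator_matrix_norm \<mu> m T =
     (SUP f\<in>{f. (\<forall>l<m. f l \<in> L2 \<mu>) \<and> (\<Sum>l<m. (L2_norm \<mu> (f l))\<^sup>2) \<le> 1}.
        sqrt (\<Sum>k<m. (L2_norm \<mu> (\<lambda>x. \<Sum>l<m. T k l (f l) x))\<^sup>2))"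

text \<open>The weak operator topology: the initial topology for the maps \<open>T \<mapsto> \<langle>T f | g\<rangle>\<close>.\<close>

definition weak_operator_topology :: "'a measure \<Rightarrow> 'a operator topology" where
  "weak_operator_topology \<mu> =
     pullback_topology (bounded_operators \<mu>)
       (\<lambda>T. \<lambda>(f, g)\<in>L2 \<mu> \<times> L2 \<mu>. L2_inner \<mu> (T f) g)
       (product_topology (\<lambda>_. euclidean) (L2 \<mu> \<times> L2 \<mu>))"


section \<open>The group von Neumann algebra and the Fourier algebra\<close>

definition left_regular :: "'a::group_add \<Rightarrow> 'a operator" where
  "left_regular x f = (\<lambda>y. f (- x + y))"

definition span_left_regular :: "'a::group_add operator set" where
  "span_left_regular =
     {(\<lambda>f y. \<Sum>x\<in>F. c x * left_regular x f y) | F c. finite F}"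

definition VN :: "'a::group_add measure \<Rightarrow> 'a operator set" where
  "VN \<mu> = (weak_operator_topology \<mu>) closure_of span_left_regular"

definition coefficient :: "'a::group_add measure \<Rightarrow> ('a \<Rightarrow> complex) \<Rightarrow> ('a \<Rightarrow> complex) \<Rightarrow> ('a \<Rightarrow> complex)" where
  "coefficient \<mu> f g = (\<lambda>x. L2_inner \<mu> (left_regular x f) g)"

definition fourier_algebra :: "'a::group_add measure \<Rightarrow> ('a \<Rightarrow> complex) set" where
  "fourier_algebra \<mu> = {coefficient \<mu> f g | f g. f \<in> L2 \<mu> \<and> g \<in> L2 \<mu>}"

text \<open>
  The duality between \<open>VN(G)\<close> and \<open>A(G)\<close>. That the value does not depend on the choice of \<open>f\<close> and \<open>g\<close>
  is \<open>VN_pairing_coefficient\<close> below.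
\<close>

definition VN_pairing :: "'a::group_add measure \<Rightarrow> 'a operator \<Rightarrow> ('a \<Rightarrow> complex) \<Rightarrow> complex" where
  "VN_pairing \<mu> T u =
     (THE z. \<exists>f\<in>L2 \<mu>. \<exists>g\<in>L2 \<mu>. u = coefficient \<mu> f g \<and> z = L2_inner \<mu> (T f) g)"

definition fourier_norm :: "'a::group_add measure \<Rightarrow> ('a \<Rightarrow> complex) \<Rightarrow> real" where
  "fourier_norm \<mu> u = (SUP T\<in>{T \<in> VN \<mu>. operator_norm \<mu> T \<le> 1}. cmod (VN_pairing \<mu> T u))"


section \<open>Operator space structures\<close>

text \<open>
  An operator space structure is given by its matrix norms: \<open>N n x\<close> is the norm of the \<open>n \<times> n\<close> matrix
  \<open>[x i j]\<close>, \<open>i, j < n\<close>.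
\<close>

type_synonym 'x matrix_norms = "nat \<Rightarrow> (nat \<Rightarrow> nat \<Rightarrow> 'x) \<Rightarrow> real"

definition complex_matrix_norm :: "'i set \<Rightarrow> ('i \<Rightarrow> 'i \<Rightarrow> complex) \<Rightarrow> real" where
  "complex_matrix_norm I M =
     (SUP v\<in>{v. (\<Sum>i\<in>I. (cmod (v i))\<^sup>2) \<le> 1}. sqrt (\<Sum>i\<in>I. (cmod (\<Sum>j\<in>I. M i j * v j))\<^sup>2))"

text \<open>
  The structure of \<open>A(G)\<close> as predual of \<open>VN(G)\<close>: the norm of \<open>[u i j]\<close> is the completely bounded norm
  of the map \<open>T \<mapsto> [\<langle>T, u i j\<rangle>]\<close> from \<open>VN(G)\<close> to the \<open>n \<times> n\<close> matrices, where the norm of a matrix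
  over \<open>VN(G)\<close> is that of the operator it defines on a direct sum of copies of \<open>L\<^sup>2(G)\<close>.
\<close>

definition fourier_matrix_norm :: "'a::group_add measure \<Rightarrow> ('a \<Rightarrow> complex) matrix_norms" where
  "fourier_matrix_norm \<mu> n u =
     (SUP (m, T)\<in>{(m, T). 1 \<le> m \<and> (\<forall>k<m. \<forall>l<m. T k l \<in> VN \<mu>) \<and> operator_matrix_norm \<mu> m T \<le> 1}.
        complex_matrix_norm ({..<m} \<times> {..<n}) (\<lambda>(k, i) (l, j). VN_pairing \<mu> (T k l) (u i j)))"

text \<open>\<open>\<ell>\<^sup>2(E)\<close> consists of functions on the whole group that vanish outside \<open>E\<close>.\<close>

definition ell2 :: "'a set \<Rightarrow> ('a \<Rightarrow> complex) set" where
  "ell2 E = {\<phi>. (\<forall>h. h \<notin> E \<longrightarrow> \<phi> h = 0) \<and> (\<lambda>h. (cmod (\<phi> h))\<^sup>2) summable_on E}"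

definition ell2_norm :: "'a set \<Rightarrow> ('a \<Rightarrow> complex) \<Rightarrow> real" where
  "ell2_norm E \<phi> = sqrt (\<Sum>\<^sub>\<infinity>h\<in>E. (cmod (\<phi> h))\<^sup>2)"

text \<open>
  The row operator Hilbert space over \<open>\<ell>\<^sup>2(E)\<close>: the norm of \<open>[\<phi> i j]\<close> is
  \<open>\<parallel>\<Sum>h\<in>E. [\<phi> i j h] [\<phi> i j h]\<^sup>*\<parallel>\<^sup>1\<^sup>/\<^sup>2\<close>; the sum of matrices is taken entrywise.
\<close>

definition ell2_row_matrix_norm :: "'a set \<Rightarrow> ('a \<Rightarrow> complex) matrix_norms" where
  "ell2_row_matrix_norm E n \<phi> =
     sqrt (complex_matrix_norm {..<n}
       (\<lambda>i j. \<Sum>\<^sub>\<infinity>h\<in>E. \<Sum>k<n. \<phi> i k h * cnj (\<phi> j k h)))"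

text \<open>
  The complex conjugate of an operator space of functions, where the conjugate vector of \<open>\<phi>\<close> is identified
  (complex linearly) with the function \<open>h \<mapsto> cnj (\<phi> h)\<close>. So a matrix \<open>[\<psi> i j]\<close> of functions corresponds to
  the conjugates of the \<open>\<phi> i j = (\<lambda>h. cnj (\<psi> i j h))\<close>.
\<close>

definition conjugate_matrix_norm :: "('a \<Rightarrow> complex) matrix_norms \<Rightarrow> ('a \<Rightarrow> complex) matrix_norms" where
  "conjugate_matrix_norm N n \<psi> = N n (\<lambda>i j h. cnj (\<psi> i j h))"

definition linear_map_between ::
  "('a \<Rightarrow> complex) set \<Rightarrow> ('b \<Rightarrow> complex) set \<Rightarrow> (('a \<Rightarrow> complex) \<Rightarrow> ('b \<Rightarrow> complex)) \<Rightarrow> bool" where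
  "linear_map_between X Y F \<longleftrightarrow>
     (\<forall>\<phi>\<in>X. F \<phi> \<in> Y) \<and>
     (\<forall>\<phi>\<in>X. \<forall>\<psi>\<in>X. F (\<lambda>h. \<phi> h + \<psi> h) = (\<lambda>x. F \<phi> x + F \<psi> x)) \<and>
     (\<forall>c. \<forall>\<phi>\<in>X. F (\<lambda>h. c * \<phi> h) = (\<lambda>x. c * F \<phi> x))"

definition contraction where
  "contraction X normX Y normY F \<longleftrightarrow>
     linear_map_between X Y F \<and> (\<forall>\<phi>\<in>X. normY (F \<phi>) \<le> (normX \<phi> :: real))"

definition complete_contraction where
  "complete_contraction X NX Y NY F \<longleftrightarrow>
     linear_map_between X Y F \<and>
     (\<forall>n\<ge>1. \<forall>\<phi>. (\<forall>i<n. \<forall>j<n. \<phi> i j \<in> X) \<longrightarrow> (NY :: _ matrix_norms) n (\<lambda>i j. F (\<phi> i j)) \<le> (NX :: _ matrix_norms) n \<phi>)"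


section \<open>The map \<open>\<Gamma>\<^sub>u\<close>\<close>

definition translate :: "'a::group_add \<Rightarrow> ('a \<Rightarrow> complex) \<Rightarrow> ('a \<Rightarrow> complex)" where
  "translate h u = (\<lambda>x. u (- h + x))"

definition Gamma_map :: "'a::group_add set \<Rightarrow> ('a \<Rightarrow> complex) \<Rightarrow> ('a \<Rightarrow> complex) \<Rightarrow> ('a \<Rightarrow> complex)" where
  "Gamma_map E u \<phi> = (\<lambda>x. \<Sum>\<^sub>\<infinity>h\<in>E. \<phi> h * translate h u x)"


section \<open>The duality is well defined\<close>

lemma L2_mult_cnj_integrable:
  assumes "f \<in> L2 \<mu>" "g \<in> L2 \<mu>"
  shows "integrable \<mu> (\<lambda>x. f x * cnj (g x))"
proof (rule Bochner_Integration.integrable_bound)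
  show "integrable \<mu> (\<lambda>x. (cmod (f x))\<^sup>2 + (cmod (g x))\<^sup>2)"
    using assms by (auto simp: L2_def)
  show "(\<lambda>x. f x * cnj (g x)) \<in> borel_measurable \<mu>"
    using assms by (auto simp: L2_def intro!: borel_measurable_times
        borel_measurable_continuous_on[OF continuous_on_cnj[OF continuous_on_id]])
  have "a * b \<le> a\<^sup>2 + b\<^sup>2" if "0 \<le> a" "0 \<le> b" for a b :: real
    using sum_squares_bound[of a b] mult_nonneg_nonneg[OF that] by linarith
  then show "AE x in \<mu>. norm (f x * cnj (g x)) \<le> norm ((cmod (f x))\<^sup>2 + (cmod (g x))\<^sup>2)"
    by (simp add: norm_mult)
qed

lemma left_regular_L2:
  fixes \<mu> :: "'a::{topological_group_add, t2_space} measure"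
  assumes haar: "left_haar_measure \<mu>" and f: "f \<in> L2 \<mu>"
  shows "left_regular x f \<in> L2 \<mu>"
proof -
  have sets: "sets \<mu> = sets borel" and inv: "\<And>A. A \<in> sets borel \<Longrightarrow> emeasure \<mu> ((\<lambda>y. x + y) ` A) = emeasure \<mu> A"
    using haar by (auto simp: left_haar_measure_def)
  have space: "space \<mu> = UNIV"
    using sets_eq_imp_space_eq[OF sets] by simp
  have "(\<lambda>y. - x + y) \<in> measurable borel borel"
    by (intro borel_measurable_continuous_onI continuous_intros)
  then have meas: "(\<lambda>y. - x + y) \<in> measurable \<mu> \<mu>"
    using measurable_cong_sets[OF sets sets] by simp
  have "distr \<mu> \<mu> (\<lambda>y. - x + y) = \<mu>"
  proof (rule measure_eqI)
    fix A assume "A \<in> sets (distr \<mu> \<mu> (\<lambda>y. - x + y))"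
    then have A: "A \<in> sets \<mu>" by simp
    have "(\<lambda>y. - x + y) -` A = (\<lambda>y. x + y) ` A"
      by (force simp: image_iff add.assoc[symmetric])
    then show "emeasure (distr \<mu> \<mu> (\<lambda>y. - x + y)) A = emeasure \<mu> A"
      using A inv[of A] sets by (simp add: emeasure_distr[OF meas A] space)
  qed simp
  then have int: "integrable \<mu> (\<lambda>y. (cmod (f (- x + y)))\<^sup>2)"
    using integrable_distr[OF meas, of "\<lambda>y. (cmod (f y))\<^sup>2"] f by (simp add: L2_def)
  have "(\<lambda>y. f (- x + y)) \<in> borel_measurable \<mu>"
    using measurable_compose[OF meas, of f borel] f by (simp add: L2_def)
  with int show ?thesis
    by (simp add: L2_def left_regular_def)
qed

lemma L2_inner_span_left_regular:
  fixes \<mu> :: "'a::{topological_group_add, t2_space} measure"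
  assumes "left_haar_measure \<mu>" "f \<in> L2 \<mu>" "g \<in> L2 \<mu>"
  shows "L2_inner \<mu> (\<lambda>y. \<Sum>x\<in>F. c x * left_regular x f y) g = (\<Sum>x\<in>F. c x * coefficient \<mu> f g x)"
proof -
  have int: "integrable \<mu> (\<lambda>y. left_regular x f y * cnj (g y))" for x
    using assms by (intro L2_mult_cnj_integrable left_regular_L2)
  have "L2_inner \<mu> (\<lambda>y. \<Sum>x\<in>F. c x * left_regular x f y) g =
      (\<integral>y. (\<Sum>x\<in>F. c x * (left_regular x f y * cnj (g y))) \<partial>\<mu>)"
    by (simp add: L2_inner_def sum_distrib_right mult.assoc)
  also have "\<dots> = (\<Sum>x\<in>F. c x * coefficient \<mu> f g x)"
    using int by (subst Bochner_Integration.integral_sum) (auto simp: coefficient_def L2_inner_def)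
  finally show ?thesis .
qed

lemma continuous_map_L2_inner:
  assumes "f \<in> L2 \<mu>" "g \<in> L2 \<mu>"
  shows "continuous_map (weak_operator_topology \<mu>) euclidean (\<lambda>T. L2_inner \<mu> (T f) g)"
proof -
  have "continuous_map (product_topology (\<lambda>_. euclidean) (L2 \<mu> \<times> L2 \<mu>)) euclidean
          (\<lambda>w. w (f, g) :: complex)"
    using assms by (intro continuous_map_product_projection) auto
  from continuous_map_pullback[OF this, of "bounded_operators \<mu>"
      "\<lambda>T. \<lambda>(f, g)\<in>L2 \<mu> \<times> L2 \<mu>. L2_inner \<mu> (T f) g"]
  show ?thesis
    using assms by (simp add: weak_operator_topology_def o_def)
qed

lemma VN_pairing_coefficient:
  fixes \<mu> :: "'a::{topological_group_add, t2_space} measure"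
  assumes haar: "left_haar_measure \<mu>" and T: "T \<in> VN \<mu>" and f: "f \<in> L2 \<mu>" and g: "g \<in> L2 \<mu>"
  shows "VN_pairing \<mu> T (coefficient \<mu> f g) = L2_inner \<mu> (T f) g"
  unfolding VN_pairing_def
proof (rule the_equality)
  show "\<exists>f'\<in>L2 \<mu>. \<exists>g'\<in>L2 \<mu>. coefficient \<mu> f g = coefficient \<mu> f' g' \<and> L2_inner \<mu> (T f) g = L2_inner \<mu> (T f') g'"
    using f g by blast
next
  fix z
  assume "\<exists>f'\<in>L2 \<mu>. \<exists>g'\<in>L2 \<mu>. coefficient \<mu> f g = coefficient \<mu> f' g' \<and> z = L2_inner \<mu> (T f') g'"
  then obtain f' g' where f': "f' \<in> L2 \<mu>" and g': "g' \<in> L2 \<mu>"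
    and eq: "coefficient \<mu> f g = coefficient \<mu> f' g'" and z: "z = L2_inner \<mu> (T f') g'"
    by blast
  show "z = L2_inner \<mu> (T f) g"
    unfolding z
  proof (rule forall_in_closure_of_eq[where f = "\<lambda>T. L2_inner \<mu> (T f') g'" and
        g = "\<lambda>T. L2_inner \<mu> (T f) g", OF T[unfolded VN_def]])
    show "Hausdorff_space (euclidean :: complex topology)" by simp
    fix S assume "S \<in> (span_left_regular :: 'a operator set)"
    then obtain F :: "'a set" and c where S: "S = (\<lambda>f y. \<Sum>x\<in>F. c x * left_regular x f y)"
      by (auto simp: span_left_regular_def)
    show "L2_inner \<mu> (S f') g' = L2_inner \<mu> (S f) g"
      unfolding S using L2_inner_span_left_regular[OF haar f g] L2_inner_span_left_regular[OF haar f' g'] eq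
      by simp
  qed (intro continuous_map_L2_inner f g f' g')+
qed

end

theory Submission
  imports Defs
begin

text \<open>
  Since \<open>u (- h + x) = \<langle>\<lambda>(x) \<xi> | \<lambda>(h) \<xi>\<rangle>\<close> and the translates \<open>\<lambda>(h) \<xi>\<close>, \<open>h \<in> E\<close>, have disjoint supports, they are
  orthonormal and \<open>\<Gamma>\<^sub>u \<phi>\<close> is the coefficient function of \<open>\<xi>\<close> and \<open>g \<phi> = \<Sum>h\<in>E. cnj (\<phi> h) \<lambda>(h) \<xi>\<close>, where
  \<open>g\<close> is a conjugate linear isometry. Hence \<open>T \<in> VN(G)\<close> pairs with \<open>\<Gamma>\<^sub>u \<phi>\<close> to \<open>\<langle>T \<xi> | g \<phi>\<rangle>\<close>, which gives (i)
  and (ii). For (iii), a contractive matrix \<open>[T k l]\<close> maps the vectors \<open>(v l j \<xi>)\<close>, \<open>l < m\<close>, to vectors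
  \<open>(f k j)\<close>, \<open>k < m\<close>, of no larger norm, and for each \<open>k\<close> the operator
  \<open>(f j) \<mapsto> (\<Sum>j. \<langle>f j | g (\<phi> i j)\<rangle>)\<close> has squared norm that of its product with its adjoint, which is up to
  transposition the matrix defining the norm of the conjugate row space.
\<close>

section \<open>The seminormed space of square integrable functions\<close>

lemma L2_measurable: "f \<in> L2 \<mu> \<Longrightarrow> f \<in> borel_measurable \<mu>"
  by (simp add: L2_def)

lemma L2_norm_nonneg: "0 \<le> L2_norm \<mu> f"
  by (simp add: L2_norm_def)

lemma L2_norm_power2: "(L2_norm \<mu> f)\<^sup>2 = (\<integral>x. (cmod (f x))\<^sup>2 \<partial>\<mu>)"
  by (simp add: L2_norm_def)

lemma L2_cmult:
  assumes "f \<in> L2 \<mu>"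
  shows "(\<lambda>x. c * f x) \<in> L2 \<mu>"
  using assms borel_measurable_times[of "\<lambda>_. c" \<mu> f] by (simp add: L2_def norm_mult power_mult_distrib)

lemma L2_norm_cmult: "L2_norm \<mu> (\<lambda>x. c * f x) = cmod c * L2_norm \<mu> f"
  by (simp add: L2_norm_def norm_mult power_mult_distrib real_sqrt_mult)

text \<open>Cauchy-Schwarz against the constant family 1. The crude factor \<open>card I\<close>
  suffices for its uses: integrability, summability and boundedness of suprema. For infinite
  \<open>I\<close> both sides are 0.\<close>

lemma cmod_sum_power2_le: "(cmod (\<Sum>i\<in>I. z i))\<^sup>2 \<le> of_nat (card I) * (\<Sum>i\<in>I. (cmod (z i))\<^sup>2)"
proof (cases "finite I")
  case True
  have "(cmod (\<Sum>i\<in>I. z i))\<^sup>2 \<le> (\<Sum>i\<in>I. cmod (z i))\<^sup>2"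
    by (intro power_mono norm_sum) auto
  also have "\<dots> \<le> (\<Sum>i\<in>I. (1::real)\<^sup>2) * (\<Sum>i\<in>I. (cmod (z i))\<^sup>2)"
    using Cauchy_Schwarz_ineq_sum[of "\<lambda>_. 1" "\<lambda>i. cmod (z i)" I] by simp
  finally show ?thesis
    by simp
qed simp

lemma L2_sum:
  assumes "\<And>i. i \<in> I \<Longrightarrow> f i \<in> L2 \<mu>"
  shows "(\<lambda>x. \<Sum>i\<in>I. f i x) \<in> L2 \<mu>"
proof -
  have meas: "(\<lambda>x. \<Sum>i\<in>I. f i x) \<in> borel_measurable \<mu>"
    using assms L2_measurable by (intro borel_measurable_sum) blast
  have "integrable \<mu> (\<lambda>x. (cmod (\<Sum>i\<in>I. f i x))\<^sup>2)"
  proof (rule Bochner_Integration.integrable_bound)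
    show "integrable \<mu> (\<lambda>x. of_nat (card I) * (\<Sum>i\<in>I. (cmod (f i x))\<^sup>2))"
      using assms by (auto simp: L2_def)
    show "AE x in \<mu>. norm ((cmod (\<Sum>i\<in>I. f i x))\<^sup>2) \<le> norm (real (card I) * (\<Sum>i\<in>I. (cmod (f i x))\<^sup>2))"
      using cmod_sum_power2_le[of "\<lambda>i. f i _" I] by (simp add: sum_nonneg)
  qed (use meas in measurable)
  with meas show ?thesis by (simp add: L2_def)
qed

lemma L2_norm_sum_power2_le:
  assumes "\<And>i. i \<in> I \<Longrightarrow> f i \<in> L2 \<mu>"
  shows "(L2_norm \<mu> (\<lambda>x. \<Sum>i\<in>I. f i x))\<^sup>2 \<le> of_nat (card I) * (\<Sum>i\<in>I. (L2_norm \<mu> (f i))\<^sup>2)"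
proof -
  have int: "integrable \<mu> (\<lambda>x. (cmod (f i x))\<^sup>2)" if "i \<in> I" for i
    using assms[OF that] by (simp add: L2_def)
  have "(\<integral>x. (cmod (\<Sum>i\<in>I. f i x))\<^sup>2 \<partial>\<mu>) \<le> (\<integral>x. of_nat (card I) * (\<Sum>i\<in>I. (cmod (f i x))\<^sup>2) \<partial>\<mu>)"
  proof (rule integral_mono)
    show "integrable \<mu> (\<lambda>x. (cmod (\<Sum>i\<in>I. f i x))\<^sup>2)"
      using L2_sum[where I = I and f = f] assms by (simp add: L2_def)
    show "integrable \<mu> (\<lambda>x. real (card I) * (\<Sum>i\<in>I. (cmod (f i x))\<^sup>2))"
      using int by simp
  qed (rule cmod_sum_power2_le)
  then show ?thesis
    using int by (simp add: L2_norm_power2)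
qed

lemma L2_norm_cong_AE:
  assumes "f \<in> borel_measurable \<mu>" "g \<in> borel_measurable \<mu>" "AE x in \<mu>. f x = g x"
  shows "L2_norm \<mu> f = L2_norm \<mu> g"
  unfolding L2_norm_def using assms by (auto intro!: arg_cong[where f = sqrt] integral_cong_AE)

lemma L2_inner_cong_AE:
  assumes "f \<in> L2 \<mu>" "f' \<in> L2 \<mu>" "g \<in> L2 \<mu>" "AE x in \<mu>. f x = f' x"
  shows "L2_inner \<mu> f g = L2_inner \<mu> f' g"
proof -
  have "(\<lambda>x. f x * cnj (g x)) \<in> borel_measurable \<mu>" "(\<lambda>x. f' x * cnj (g x)) \<in> borel_measurable \<mu>"
    using assms(1-3) by (auto intro: borel_measurable_integrable L2_mult_cnj_integrable)
  then show ?thesis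
    unfolding L2_inner_def using assms(4) by (auto intro!: integral_cong_AE)
qed

lemma L2_inner_cmult_left: "L2_inner \<mu> (\<lambda>x. c * f x) g = c * L2_inner \<mu> f g"
  by (simp add: L2_inner_def mult.assoc)

lemma L2_inner_cmult_right: "L2_inner \<mu> f (\<lambda>x. c * g x) = cnj c * L2_inner \<mu> f g"
  by (simp add: L2_inner_def mult.left_commute)

lemma L2_inner_add_right:
  assumes "f \<in> L2 \<mu>" "g \<in> L2 \<mu>" "h \<in> L2 \<mu>"
  shows "L2_inner \<mu> f (\<lambda>x. g x + h x) = L2_inner \<mu> f g + L2_inner \<mu> f h"
  unfolding L2_inner_def complex_cnj_add distrib_left
  using assms by (intro Bochner_Integration.integral_add L2_mult_cnj_integrable)

lemma L2_inner_sum_left: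
  assumes "\<And>i. i \<in> I \<Longrightarrow> f i \<in> L2 \<mu>" "g \<in> L2 \<mu>"
  shows "L2_inner \<mu> (\<lambda>x. \<Sum>i\<in>I. f i x) g = (\<Sum>i\<in>I. L2_inner \<mu> (f i) g)"
  unfolding L2_inner_def sum_distrib_right
  using assms by (intro Bochner_Integration.integral_sum L2_mult_cnj_integrable)

lemma L2_inner_sum_right:
  assumes "f \<in> L2 \<mu>" "\<And>i. i \<in> I \<Longrightarrow> g i \<in> L2 \<mu>"
  shows "L2_inner \<mu> f (\<lambda>x. \<Sum>i\<in>I. g i x) = (\<Sum>i\<in>I. L2_inner \<mu> f (g i))"
  unfolding L2_inner_def cnj_sum sum_distrib_left
  using assms by (intro Bochner_Integration.integral_sum L2_mult_cnj_integrable)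

text \<open>Integrates the weighted inequality \<open>2ab <= (t/s) a^2 + (s/t) b^2\<close>, with
  weights chosen from the two norms. These may vanish, so both are raised by \<open>e > 0\<close>,
  and \<open>e\<close> tends to 0 at the end.\<close>

lemma L2_Cauchy_Schwarz:
  assumes f: "f \<in> L2 \<mu>" and g: "g \<in> L2 \<mu>"
  shows "cmod (L2_inner \<mu> f g) \<le> L2_norm \<mu> f * L2_norm \<mu> g"
proof -
  let ?A = "L2_norm \<mu> f" and ?B = "L2_norm \<mu> g" and ?I = "\<integral>x. cmod (f x * cnj (g x)) \<partial>\<mu>"
  note intf = f[unfolded L2_def, simplified, THEN conjunct2]
  note intg = g[unfolded L2_def, simplified, THEN conjunct2]
  have *: "?I \<le> (?A + e) * (?B + e)" if "0 < e" for e
  proof -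
    define s where "s = ?A + e"
    define t where "t = ?B + e"
    have pos: "0 < s" "0 < t" "?A \<le> s" "?B \<le> t"
      using that L2_norm_nonneg[of \<mu> f] L2_norm_nonneg[of \<mu> g] by (auto simp: s_def t_def)
    have "?I \<le> (\<integral>x. ((t / s) * (cmod (f x))\<^sup>2 + (s / t) * (cmod (g x))\<^sup>2) / 2 \<partial>\<mu>)"
    proof (rule integral_mono)
      show "integrable \<mu> (\<lambda>x. cmod (f x * cnj (g x)))"
        using L2_mult_cnj_integrable[OF f g] by (rule integrable_norm)
      show "integrable \<mu> (\<lambda>x. ((t / s) * (cmod (f x))\<^sup>2 + (s / t) * (cmod (g x))\<^sup>2) / 2)"
        using intf intg by auto
      fix x
      have "0 \<le> (t * cmod (f x) - s * cmod (g x))\<^sup>2 / (s * t)"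
        using pos by simp
      also have "\<dots> = (t / s) * (cmod (f x))\<^sup>2 + (s / t) * (cmod (g x))\<^sup>2 - 2 * (cmod (f x) * cmod (g x))"
        using pos by (simp add: field_simps power2_eq_square)
      finally show "cmod (f x * cnj (g x)) \<le> ((t / s) * (cmod (f x))\<^sup>2 + (s / t) * (cmod (g x))\<^sup>2) / 2"
        by (simp add: norm_mult)
    qed
    also have "\<dots> = ((t / s) * ?A\<^sup>2 + (s / t) * ?B\<^sup>2) / 2"
      using intf intg by (simp add: L2_norm_power2)
    \<comment> \<open>Replacing the norms by their upper bounds \<open>s\<close> and
      \<open>t\<close> makes both summands equal to \<open>s * t\<close>.\<close>
    also have "\<dots> \<le> ((t / s) * s\<^sup>2 + (s / t) * t\<^sup>2) / 2"
      using pos L2_norm_nonneg[of \<mu>] by (intro divide_right_mono add_mono mult_left_mono power_mono) auto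
    also have "\<dots> = s * t"
      using pos by (simp add: power2_eq_square)
    finally show ?thesis
      by (simp add: s_def t_def)
  qed
  have "((\<lambda>e. (?A + e) * (?B + e)) \<longlongrightarrow> (?A + 0) * (?B + 0)) (at_right 0)"
    by (intro tendsto_intros)
  moreover have "\<forall>\<^sub>F e in at_right 0. ?I \<le> (?A + e) * (?B + e)"
    using * by (auto simp: eventually_at_right_less intro: eventually_mono[OF eventually_at_right_less])
  ultimately have "?I \<le> ?A * ?B"
    using tendsto_lowerbound[of _ _ "at_right (0::real)" ?I] by simp
  then show ?thesis
    unfolding L2_inner_def using integral_norm_bound[of \<mu> "\<lambda>x. f x * cnj (g x)"] by linarith
qed

section \<open>Orthonormal families of functions with disjoint supports\<close>

text \<open>Disjoint supports are more than orthogonality: at each point at most one term of a sum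
  over \<open>E\<close> is nonzero, so such sums make sense pointwise even for uncountable
  \<open>E\<close>.\<close>

locale disjoint_family_L2 =
  fixes \<mu> :: "'a measure" and E :: "'i set" and e :: "'i \<Rightarrow> 'a \<Rightarrow> complex"
  assumes e_L2: "h \<in> E \<Longrightarrow> e h \<in> L2 \<mu>"
    and e_norm: "h \<in> E \<Longrightarrow> L2_norm \<mu> (e h) = 1"
    and e_disjoint: "h \<in> E \<Longrightarrow> k \<in> E \<Longrightarrow> h \<noteq> k \<Longrightarrow> e h y = 0 \<or> e k y = 0"
begin

text \<open>The orthonormal expansion, taken pointwise rather than as a limit in
  \<open>L2 \<mu>\<close>, so that it is an actual function and no representative has to be
  chosen.\<close>

definition synthesis :: "('i \<Rightarrow> complex) \<Rightarrow> 'a \<Rightarrow> complex" where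
  "synthesis a y = (\<Sum>\<^sub>\<infinity>h\<in>E. a h * e h y)"

text \<open>The case split behind the pointwise identities for \<open>synthesis\<close>: each sum
  reduces to no term or to one.\<close>

lemma pointwise_cases:
  obtains (none) "\<And>h. h \<in> E \<Longrightarrow> e h y = 0"
  | (single) k where "k \<in> E" "\<And>h. h \<in> E \<Longrightarrow> h \<noteq> k \<Longrightarrow> e h y = 0"
  using e_disjoint by metis

lemma synthesis_eq_single:
  assumes "k \<in> E" "\<And>h. h \<in> E \<Longrightarrow> h \<noteq> k \<Longrightarrow> e h y = 0"
  shows "synthesis a y = a k * e k y"
proof -
  have "synthesis a y = (\<Sum>\<^sub>\<infinity>h\<in>{k}. a h * e h y)"
    unfolding synthesis_def using assms by (intro infsum_cong_neutral) auto
  then show ?thesis by simp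
qed

lemma synthesis_eq_0:
  assumes "\<And>h. h \<in> E \<Longrightarrow> e h y = 0"
  shows "synthesis a y = 0"
  unfolding synthesis_def using assms by (intro infsum_0) auto

lemma synthesis_cong: "(\<And>h. h \<in> E \<Longrightarrow> a h = b h) \<Longrightarrow> synthesis a = synthesis b"
  unfolding synthesis_def by (auto intro!: infsum_cong)

lemma synthesis_sum:
  "synthesis (\<lambda>h. \<Sum>i\<in>I. c i * a i h) y = (\<Sum>i\<in>I. c i * synthesis (a i) y)"
proof (cases rule: pointwise_cases[of y])
  case none
  then show ?thesis by (simp add: synthesis_eq_0)
next
  case (single k)
  then show ?thesis
    by (simp add: synthesis_eq_single[OF single] sum_distrib_right mult.assoc)
qed

lemma synthesis_add:
  "synthesis (\<lambda>h. a h + b h) y = synthesis a y + synthesis b y"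
proof (cases rule: pointwise_cases[of y])
  case none
  then show ?thesis by (simp add: synthesis_eq_0)
next
  case (single k)
  then show ?thesis
    by (simp add: synthesis_eq_single[OF single] distrib_right)
qed

lemma synthesis_finite_support:
  assumes "finite F" "F \<subseteq> E"
  shows "synthesis (\<lambda>h. if h \<in> F then a h else 0) y = (\<Sum>h\<in>F. a h * e h y)"
proof -
  have "synthesis (\<lambda>h. if h \<in> F then a h else 0) y = (\<Sum>\<^sub>\<infinity>h\<in>F. a h * e h y)"
    unfolding synthesis_def using assms by (intro infsum_cong_neutral) auto
  then show ?thesis using assms by simp
qed

lemma countable_support:
  fixes a :: "'i \<Rightarrow> complex"
  assumes "(\<lambda>h. (cmod (a h))\<^sup>2) summable_on E"
  shows "countable {h \<in> E. a h \<noteq> 0}"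
  using summable_countable_real[OF assms] by simp

text \<open>Finite partial sums along an enumeration of the support are measurable, and by
  disjointness they are eventually constant at each point.\<close>

lemma synthesis_measurable:
  assumes "countable {h \<in> E. a h \<noteq> 0}"
  shows "synthesis a \<in> borel_measurable \<mu>"
proof (cases "{h \<in> E. a h \<noteq> 0} = {}")
  case True
  then have "synthesis a = (\<lambda>_. 0)"
    unfolding synthesis_def by (auto intro!: infsum_0)
  then show ?thesis by simp
next
  case False
  let ?S = "{h \<in> E. a h \<noteq> 0}"
  \<comment> \<open>\<open>from_nat_into\<close> may repeat elements; taking the image as a set
    counts each index once.\<close>
  define F where "F n = from_nat_into ?S ` {..<n}" for n
  have FE: "F n \<subseteq> ?S" "finite (F n)" for n
    using from_nat_into[OF False] by (auto simp: F_def)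
  show ?thesis
  proof (rule borel_measurable_LIMSEQ_metric)
    show "(\<lambda>y. \<Sum>h\<in>F n. a h * e h y) \<in> borel_measurable \<mu>" for n
      using FE e_L2[THEN L2_measurable] by (intro borel_measurable_sum borel_measurable_times) auto
    fix y
    have "\<forall>\<^sub>F n in sequentially. (\<Sum>h\<in>F n. a h * e h y) = synthesis a y"
    proof (cases rule: pointwise_cases[of y])
      case none
      then show ?thesis
        using FE by (intro always_eventually allI) (fastforce simp: synthesis_eq_0 intro!: sum.neutral)
    next
      case (single k)
      show ?thesis
      proof (cases "k \<in> ?S")
        case True
        then obtain m where m: "from_nat_into ?S m = k"
          using from_nat_into_surj[OF assms] by blast
        \<comment> \<open>The index \<open>k\<close> has been enumerated as soon as
          \<open>m < n\<close>, and no other index contributes at \<open>y\<close>.\<close>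
        have "(\<Sum>h\<in>F n. a h * e h y) = a k * e k y" if "m < n" for n
        proof -
          have "k \<in> F n" using m that by (auto simp: F_def)
          moreover have "a h * e h y = 0" if "h \<in> F n - {k}" for h
            using FE[of n] single that by auto
          ultimately show ?thesis
            using FE[of n] by (simp add: sum.remove[of _ k] sum.neutral)
        qed
        then show ?thesis
          unfolding eventually_sequentially using synthesis_eq_single[OF single]
          by (intro exI[of _ "Suc m"]) auto
      next
        case False
        then have "a k = 0" using single by simp
        have "(\<Sum>h\<in>F n. a h * e h y) = 0" for n
        proof (rule sum.neutral, rule ballI)
          fix h assume "h \<in> F n"
          then have "h \<in> ?S" using FE by blast
          then show "a h * e h y = 0" using single False by (cases "h = k") auto
        qed
        then show ?thesis
          by (simp add: synthesis_eq_single[OF single] \<open>a k = 0\<close>)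
      qed
    qed
    then show "(\<lambda>n. \<Sum>h\<in>F n. a h * e h y) \<longlonglongrightarrow> synthesis a y"
      by (rule tendsto_eventually)
  qed
qed

text \<open>Parseval. Disjointness makes the squared modulus of the sum equal to the sum of the
  squared moduli at each point; Tonelli against the counting measure on the countable support then
  allows termwise integration.\<close>

lemma nn_integral_synthesis:
  fixes a :: "'i \<Rightarrow> complex"
  assumes sq: "(\<lambda>h. (cmod (a h))\<^sup>2) summable_on E"
  shows "(\<integral>\<^sup>+y. ennreal ((cmod (synthesis a y))\<^sup>2) \<partial>\<mu>) = ennreal (\<Sum>\<^sub>\<infinity>h\<in>E. (cmod (a h))\<^sup>2)"
proof -
  let ?S = "{h \<in> E. a h \<noteq> 0}"
  let ?t = "\<lambda>h y. ennreal ((cmod (a h * e h y))\<^sup>2)"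
  have cnt: "countable ?S" using sq by (rule countable_support)
  have pt: "ennreal ((cmod (synthesis a y))\<^sup>2) = (\<integral>\<^sup>+h. ?t h y \<partial>count_space ?S)" for y
  proof (cases rule: pointwise_cases[of y])
    case none
    then have "(\<integral>\<^sup>+h. ?t h y \<partial>count_space ?S) = (\<integral>\<^sup>+h. 0 \<partial>count_space ?S)"
      by (intro nn_integral_cong) auto
    then show ?thesis using none by (simp add: synthesis_eq_0)
  next
    case (single k)
    have "(\<integral>\<^sup>+h. ?t h y \<partial>count_space ?S) = (\<Sum>h\<in>?S \<inter> {k}. ?t h y)"
      using single by (intro nn_integral_count_space') (auto split: if_splits)
    also have "\<dots> = ?t k y"
      using single by (cases "a k = 0") auto
    finally show ?thesis by (simp add: synthesis_eq_single[OF single])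
  qed
  have one: "(\<integral>\<^sup>+y. ?t h y \<partial>\<mu>) = ennreal ((cmod (a h))\<^sup>2)" if "h \<in> E" for h
  proof -
    have "(\<integral>\<^sup>+y. ?t h y \<partial>\<mu>) = ennreal (\<integral>y. (cmod (a h * e h y))\<^sup>2 \<partial>\<mu>)"
      using L2_cmult[OF e_L2[OF that], of "a h"] by (intro nn_integral_eq_integral) (auto simp: L2_def)
    also have "(\<integral>y. (cmod (a h * e h y))\<^sup>2 \<partial>\<mu>) = (cmod (a h))\<^sup>2"
      unfolding L2_norm_power2[symmetric] L2_norm_cmult e_norm[OF that] by simp
    finally show ?thesis .
  qed
  \<comment> \<open>Integrals over a counting measure are evaluated by \<open>infsetsum\<close>, so
    absolute summability is carried over to that notion of sum and the value is carried back
    below.\<close>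
  have "(\<lambda>h. (cmod (a h))\<^sup>2) summable_on ?S"
    by (rule summable_on_subset_banach[OF sq]) auto
  then have "Infinite_Sum.abs_summable_on (\<lambda>h. (cmod (a h))\<^sup>2) ?S"
    by (rule summable_on_iff_abs_summable_on_real[THEN iffD1])
  then have abs: "Infinite_Set_Sum.abs_summable_on (\<lambda>h. (cmod (a h))\<^sup>2) ?S"
    by (simp only: abs_summable_equivalent)
  have "(\<integral>\<^sup>+y. ennreal ((cmod (synthesis a y))\<^sup>2) \<partial>\<mu>) = (\<integral>\<^sup>+y. \<integral>\<^sup>+h. ?t h y \<partial>count_space ?S \<partial>\<mu>)"
    by (simp only: pt)
  also have "\<dots> = (\<integral>\<^sup>+h. \<integral>\<^sup>+y. ?t h y \<partial>\<mu> \<partial>count_space ?S)"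
    using e_L2[THEN L2_measurable] by (intro nn_integral_count_space_nn_integral cnt) auto
  also have "\<dots> = (\<integral>\<^sup>+h. ennreal ((cmod (a h))\<^sup>2) \<partial>count_space ?S)"
    by (intro nn_integral_cong) (simp add: one)
  also have "\<dots> = ennreal (infsetsum (\<lambda>h. (cmod (a h))\<^sup>2) ?S)"
    by (rule nn_integral_conv_infsetsum[OF abs]) auto
  also have "infsetsum (\<lambda>h. (cmod (a h))\<^sup>2) ?S = (\<Sum>\<^sub>\<infinity>h\<in>?S. (cmod (a h))\<^sup>2)"
    by (rule infsetsum_infsum[OF abs])
  also have "\<dots> = (\<Sum>\<^sub>\<infinity>h\<in>E. (cmod (a h))\<^sup>2)"
    by (intro infsum_cong_neutral) auto
  finally show ?thesis .
qed

lemma synthesis_L2: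
  assumes "(\<lambda>h. (cmod (a h))\<^sup>2) summable_on E"
  shows "synthesis a \<in> L2 \<mu>"
proof -
  have [measurable]: "synthesis a \<in> borel_measurable \<mu>"
    using assms by (intro synthesis_measurable countable_support)
  have "integrable \<mu> (\<lambda>y. (cmod (synthesis a y))\<^sup>2)"
    by (rule integrableI_bounded) (simp_all add: nn_integral_synthesis[OF assms])
  then show ?thesis by (simp add: L2_def)
qed

lemma synthesis_norm_power2:
  assumes "(\<lambda>h. (cmod (a h))\<^sup>2) summable_on E"
  shows "(L2_norm \<mu> (synthesis a))\<^sup>2 = (\<Sum>\<^sub>\<infinity>h\<in>E. (cmod (a h))\<^sup>2)"
proof -
  have "(L2_norm \<mu> (synthesis a))\<^sup>2 = enn2real (\<integral>\<^sup>+y. ennreal ((cmod (synthesis a y))\<^sup>2) \<partial>\<mu>)"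
    unfolding L2_norm_power2 using synthesis_L2[OF assms]
    by (intro integral_eq_nn_integral) (auto simp: L2_def)
  then show ?thesis
    by (simp add: nn_integral_synthesis[OF assms] infsum_nonneg)
qed

text \<open>After a finite set \<open>F\<close> of terms the error is the inner product with the
  synthesis of the tail. By Cauchy-Schwarz and Parseval it is at most \<open>L2_norm \<mu> f\<close>
  times the square root of the tail sum, which tends to 0.\<close>

lemma L2_inner_synthesis:
  assumes f: "f \<in> L2 \<mu>" and sq: "(\<lambda>h. (cmod (a h))\<^sup>2) summable_on E"
  shows "((\<lambda>h. cnj (a h) * L2_inner \<mu> f (e h)) has_sum L2_inner \<mu> f (synthesis a)) E"
proof -
  let ?q = "\<lambda>h. (cmod (a h))\<^sup>2"
  let ?N = "\<Sum>\<^sub>\<infinity>h\<in>E. ?q h"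
  have bound: "cmod ((\<Sum>h\<in>F. cnj (a h) * L2_inner \<mu> f (e h)) - L2_inner \<mu> f (synthesis a))
      \<le> L2_norm \<mu> f * sqrt (?N - (\<Sum>h\<in>F. ?q h))" if F: "finite F" "F \<subseteq> E" for F
  proof -
    \<comment> \<open>The tail of \<open>a\<close> outside \<open>F\<close>; what it leaves out is a
      finite sum.\<close>
    let ?b = "\<lambda>h. if h \<in> F then 0 else a h"
    have sb: "(\<lambda>h. (cmod (?b h))\<^sup>2) summable_on E"
      by (rule summable_on_comparison_test[OF sq]) auto
    have "synthesis a y = synthesis ?b y + synthesis (\<lambda>h. if h \<in> F then a h else 0) y" for y
      unfolding synthesis_add[symmetric] by (intro fun_cong[OF synthesis_cong]) simp
    then have "L2_inner \<mu> f (synthesis a) =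
        L2_inner \<mu> f (\<lambda>y. synthesis ?b y + (\<Sum>h\<in>F. a h * e h y))"
      unfolding synthesis_finite_support[OF F] by (intro arg_cong[where f = "L2_inner \<mu> f"] ext)
    also have "\<dots> = L2_inner \<mu> f (synthesis ?b) + L2_inner \<mu> f (\<lambda>y. \<Sum>h\<in>F. a h * e h y)"
      using F by (intro L2_inner_add_right f synthesis_L2 sb L2_sum L2_cmult e_L2) auto
    also have "L2_inner \<mu> f (\<lambda>y. \<Sum>h\<in>F. a h * e h y) = (\<Sum>h\<in>F. L2_inner \<mu> f (\<lambda>y. a h * e h y))"
      using F by (intro L2_inner_sum_right f L2_cmult e_L2) auto
    finally have "cmod ((\<Sum>h\<in>F. cnj (a h) * L2_inner \<mu> f (e h)) - L2_inner \<mu> f (synthesis a)) =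
        cmod (L2_inner \<mu> f (synthesis ?b))"
      by (simp add: L2_inner_cmult_right)
    also have "\<dots> \<le> L2_norm \<mu> f * L2_norm \<mu> (synthesis ?b)"
      by (intro L2_Cauchy_Schwarz f synthesis_L2 sb)
    also have "L2_norm \<mu> (synthesis ?b) = sqrt (\<Sum>\<^sub>\<infinity>h\<in>E. (cmod (?b h))\<^sup>2)"
      using synthesis_norm_power2[OF sb] L2_norm_nonneg by (metis real_sqrt_unique)
    also have "(\<Sum>\<^sub>\<infinity>h\<in>E. (cmod (?b h))\<^sup>2) = (\<Sum>\<^sub>\<infinity>h\<in>E - F. ?q h)"
      by (intro infsum_cong_neutral) auto
    also have "\<dots> = ?N - (\<Sum>h\<in>F. ?q h)"
      using F sq by (simp add: infsum_Diff)
    finally show ?thesis .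
  qed
  have "((\<lambda>F. \<Sum>h\<in>F. ?q h) \<longlongrightarrow> ?N) (finite_subsets_at_top E)"
    using sq has_sum_infsum by (auto simp: has_sum_def)
  then have "((\<lambda>F. L2_norm \<mu> f * sqrt (?N - (\<Sum>h\<in>F. ?q h))) \<longlongrightarrow> L2_norm \<mu> f * sqrt (?N - ?N)) (finite_subsets_at_top E)"
    by (intro tendsto_intros)
  then have "((\<lambda>F. (\<Sum>h\<in>F. cnj (a h) * L2_inner \<mu> f (e h)) - L2_inner \<mu> f (synthesis a)) \<longlongrightarrow> 0) (finite_subsets_at_top E)"
    by (intro Lim_null_comparison[OF eventually_finite_subsets_at_top_weakI[OF bound]]) simp_all
  then show ?thesis
    unfolding has_sum_def by (simp add: LIM_zero_iff)
qed

end

section \<open>Square summable families\<close>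

lemma has_sum_sum:
  fixes f :: "'i \<Rightarrow> 'a \<Rightarrow> 'b::topological_comm_monoid_add"
  assumes "\<And>i. i \<in> I \<Longrightarrow> (f i has_sum s i) A"
  shows "((\<lambda>x. \<Sum>i\<in>I. f i x) has_sum (\<Sum>i\<in>I. s i)) A"
  using assms by (induction I rule: infinite_finite_induct) (auto intro: has_sum_add)

lemma ell2_sum:
  assumes "\<And>i. i \<in> I \<Longrightarrow> a i \<in> ell2 E"
  shows "(\<lambda>h. \<Sum>i\<in>I. c i * a i h) \<in> ell2 E"
proof -
  have "(\<lambda>h. (cmod (\<Sum>i\<in>I. c i * a i h))\<^sup>2) summable_on E"
  proof (rule summable_on_comparison_test)
    have "(\<lambda>h. (cmod (c i))\<^sup>2 * (cmod (a i h))\<^sup>2) summable_on E" if "i \<in> I" for i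
      using assms[OF that] by (intro summable_on_cmult_right) (simp add: ell2_def)
    then have "(\<lambda>h. \<Sum>i\<in>I. (cmod (c i))\<^sup>2 * (cmod (a i h))\<^sup>2) summable_on E"
      by (rule has_sum_imp_summable[OF has_sum_sum[OF has_sum_infsum]])
    then show "(\<lambda>h. of_nat (card I) * (\<Sum>i\<in>I. (cmod (c i))\<^sup>2 * (cmod (a i h))\<^sup>2)) summable_on E"
      by (rule summable_on_cmult_right)
    show "(cmod (\<Sum>i\<in>I. c i * a i h))\<^sup>2 \<le> of_nat (card I) * (\<Sum>i\<in>I. (cmod (c i))\<^sup>2 * (cmod (a i h))\<^sup>2)" for h
      using cmod_sum_power2_le[of "\<lambda>i. c i * a i h" I] by (simp add: norm_mult power_mult_distrib)
  qed auto
  then show ?thesis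
    using assms by (auto simp: ell2_def intro!: sum.neutral)
qed

lemma ell2_cmult: "a \<in> ell2 E \<Longrightarrow> (\<lambda>h. c * a h) \<in> ell2 E"
  using ell2_sum[of "{()}" "\<lambda>_. a" E "\<lambda>_. c"] by simp

lemma ell2_cnj: "a \<in> ell2 E \<Longrightarrow> (\<lambda>h. cnj (a h)) \<in> ell2 E"
  by (simp add: ell2_def)

lemma ell2_add:
  assumes "a \<in> ell2 E" "b \<in> ell2 E"
  shows "(\<lambda>h. a h + b h) \<in> ell2 E"
  using ell2_sum[of "{True, False}" "\<lambda>i. if i then a else b" E "\<lambda>_. 1"] assms by simp

lemma ell2_mult_cnj_summable:
  assumes "a \<in> ell2 E" "b \<in> ell2 E"
  shows "(\<lambda>h. a h * cnj (b h)) summable_on E"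
proof -
  have "Infinite_Sum.abs_summable_on (\<lambda>h. a h * cnj (b h)) E"
    by (rule abs_summable_product) (use assms in \<open>simp_all add: ell2_def norm_mult power2_eq_square\<close>)
  then show ?thesis
    by (rule abs_summable_summable)
qed

text \<open>The infinite sums on the right are the entries of the Gram matrix of the
  \<open>a i\<close>, so squared norms of combinations become quadratic forms of that
  matrix.\<close>

lemma infsum_power2_cmod_sum:
  assumes a: "\<And>i. i \<in> I \<Longrightarrow> a i \<in> ell2 E"
  shows "complex_of_real (\<Sum>\<^sub>\<infinity>h\<in>E. (cmod (\<Sum>i\<in>I. w i * a i h))\<^sup>2) =
    (\<Sum>i\<in>I. \<Sum>j\<in>I. w i * cnj (w j) * (\<Sum>\<^sub>\<infinity>h\<in>E. a i h * cnj (a j h)))"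
proof -
  have "complex_of_real (\<Sum>\<^sub>\<infinity>h\<in>E. (cmod (\<Sum>i\<in>I. w i * a i h))\<^sup>2) =
      (\<Sum>\<^sub>\<infinity>h\<in>E. complex_of_real ((cmod (\<Sum>i\<in>I. w i * a i h))\<^sup>2))"
    by (intro infsumI[symmetric] has_sum_of_real has_sum_infsum) (use ell2_sum[where I = I and a = a and c = w and E = E] a in \<open>auto simp: ell2_def\<close>)
  also have "\<dots> = (\<Sum>\<^sub>\<infinity>h\<in>E. \<Sum>i\<in>I. \<Sum>j\<in>I. w i * cnj (w j) * (a i h * cnj (a j h)))"
    by (intro infsum_cong) (simp add: complex_norm_square sum_product mult_ac del: of_real_power)
  also have "\<dots> = (\<Sum>i\<in>I. \<Sum>j\<in>I. w i * cnj (w j) * (\<Sum>\<^sub>\<infinity>h\<in>E. a i h * cnj (a j h)))"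
    using a by (intro infsumI has_sum_sum has_sum_cmult_right has_sum_infsum ell2_mult_cnj_summable)
  finally show ?thesis .
qed

section \<open>Matrix norms\<close>

text \<open>A real supremum dominates its members only over a bounded set. On the unit ball each
  \<open>cmod (v j)\<close> with \<open>j\<close> in \<open>I\<close> is at most 1, which gives a
  bound in terms of the entries.\<close>

lemma bdd_above_complex_matrix_norm:
  assumes "finite I"
  shows "bdd_above ((\<lambda>v. sqrt (\<Sum>i\<in>I. (cmod (\<Sum>j\<in>I. M i j * v j))\<^sup>2)) ` {v. (\<Sum>i\<in>I. (cmod (v i))\<^sup>2) \<le> 1})"
proof (rule bdd_aboveI2)
  fix v assume "v \<in> {v. (\<Sum>i\<in>I. (cmod (v i))\<^sup>2) \<le> 1}"
  then have v: "(\<Sum>i\<in>I. (cmod (v i))\<^sup>2) \<le> 1" by simp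
  have v1: "(cmod (v j))\<^sup>2 \<le> 1" if "j \<in> I" for j
    using member_le_sum[OF that, of "\<lambda>i. (cmod (v i))\<^sup>2"] v assms by simp
  have "(cmod (\<Sum>j\<in>I. M i j * v j))\<^sup>2 \<le> of_nat (card I) * (\<Sum>j\<in>I. (cmod (M i j))\<^sup>2 * 1)" for i
  proof (rule order.trans[OF cmod_sum_power2_le])
    show "real (card I) * (\<Sum>j\<in>I. (cmod (M i j * v j))\<^sup>2) \<le> of_nat (card I) * (\<Sum>j\<in>I. (cmod (M i j))\<^sup>2 * 1)"
      unfolding norm_mult power_mult_distrib using v1 by (intro mult_left_mono sum_mono) auto
  qed
  then show "sqrt (\<Sum>i\<in>I. (cmod (\<Sum>j\<in>I. M i j * v j))\<^sup>2) \<le>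
      sqrt (\<Sum>i\<in>I. of_nat (card I) * (\<Sum>j\<in>I. (cmod (M i j))\<^sup>2 * 1))"
    by (intro real_sqrt_le_mono sum_mono)
qed

lemma complex_matrix_norm_nonneg:
  assumes "finite I"
  shows "0 \<le> complex_matrix_norm I M"
  unfolding complex_matrix_norm_def
  by (rule cSUP_upper2[OF bdd_above_complex_matrix_norm[OF assms], of "\<lambda>_. 0"]) simp_all

text \<open>Homogeneity extends the bound from the unit ball to all \<open>v\<close>. A
  \<open>v\<close> vanishing on \<open>I\<close> cannot be normalized, but makes both sides
  0.\<close>

lemma complex_matrix_norm_bound:
  assumes fin: "finite I"
  shows "sqrt (\<Sum>i\<in>I. (cmod (\<Sum>j\<in>I. M i j * v j))\<^sup>2) \<le>
    complex_matrix_norm I M * sqrt (\<Sum>i\<in>I. (cmod (v i))\<^sup>2)"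
proof (cases "(\<Sum>i\<in>I. (cmod (v i))\<^sup>2) = 0")
  case True
  then have "\<forall>i\<in>I. v i = 0"
    using fin by (simp add: sum_nonneg_eq_0_iff)
  then show ?thesis by simp
next
  case False
  define s where "s = sqrt (\<Sum>i\<in>I. (cmod (v i))\<^sup>2)"
  have s2: "s\<^sup>2 = (\<Sum>i\<in>I. (cmod (v i))\<^sup>2)" and s: "0 < s"
    using False sum_nonneg[of I "\<lambda>i. (cmod (v i))\<^sup>2"] by (auto simp: s_def)
  define v' where "v' j = v j / s" for j
  have "(\<Sum>i\<in>I. (cmod (v' i))\<^sup>2) = 1"
    using s by (simp add: v'_def norm_divide power_divide flip: sum_divide_distrib s2)
  then have "sqrt (\<Sum>i\<in>I. (cmod (\<Sum>j\<in>I. M i j * v' j))\<^sup>2) \<le> complex_matrix_norm I M"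
    unfolding complex_matrix_norm_def
    by (intro cSUP_upper bdd_above_complex_matrix_norm fin) simp
  moreover have "(\<Sum>i\<in>I. (cmod (\<Sum>j\<in>I. M i j * v' j))\<^sup>2) = (\<Sum>i\<in>I. (cmod (\<Sum>j\<in>I. M i j * v j))\<^sup>2) / s\<^sup>2"
    using s by (simp add: v'_def norm_divide power_divide flip: sum_divide_distrib)
  ultimately show ?thesis
    using s by (simp add: real_sqrt_divide divide_le_eq flip: s_def)
qed

text \<open>Cauchy-Schwarz for the inner product of \<open>M v\<close> with \<open>v\<close>. It is
  applied later to the Gram matrix that defines the row norm.\<close>

lemma complex_matrix_norm_quadratic_form:
  assumes fin: "finite I"
  shows "cmod (\<Sum>i\<in>I. (\<Sum>j\<in>I. M i j * v j) * cnj (v i)) \<le> complex_matrix_norm I M * (\<Sum>i\<in>I. (cmod (v i))\<^sup>2)"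
proof -
  have "cmod (\<Sum>i\<in>I. (\<Sum>j\<in>I. M i j * v j) * cnj (v i)) \<le>
      (\<Sum>i\<in>I. \<bar>cmod (\<Sum>j\<in>I. M i j * v j)\<bar> * \<bar>cmod (v i)\<bar>)"
    by (rule order.trans[OF norm_sum]) (simp add: norm_mult)
  also have "\<dots> \<le> L2_set (\<lambda>i. cmod (\<Sum>j\<in>I. M i j * v j)) I * L2_set (\<lambda>i. cmod (v i)) I"
    by (rule L2_set_mult_ineq)
  also have "\<dots> \<le> (complex_matrix_norm I M * sqrt (\<Sum>i\<in>I. (cmod (v i))\<^sup>2)) * sqrt (\<Sum>i\<in>I. (cmod (v i))\<^sup>2)"
    unfolding L2_set_def by (intro mult_right_mono complex_matrix_norm_bound fin) (simp add: sum_nonneg)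
  also have "\<dots> = complex_matrix_norm I M * (\<Sum>i\<in>I. (cmod (v i))\<^sup>2)"
    by (simp add: mult.assoc sum_nonneg)
  finally show ?thesis .
qed

section \<open>Row estimate for pairings with synthesized vectors\<close>

context disjoint_family_L2
begin

text \<open>Orthonormality. This Kronecker delta is what (i) comes down to.\<close>

lemma L2_inner_family:
  assumes "h \<in> E" "k \<in> E"
  shows "L2_inner \<mu> (e h) (e k) = (if h = k then 1 else 0)"
proof (cases "h = k")
  case True
  have "L2_inner \<mu> (e k) (e k) = complex_of_real ((L2_norm \<mu> (e k))\<^sup>2)"
    unfolding L2_norm_power2 L2_inner_def integral_complex_of_real[symmetric] complex_norm_square ..
  then show ?thesis using True assms e_norm by simp
next
  case False
  have "(\<lambda>x. e h x * cnj (e k x)) = (\<lambda>_. 0)"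
    using e_disjoint[OF assms False] by fastforce
  then show ?thesis
    using False by (simp add: L2_inner_def)
qed

text \<open>
  With \<open>w i\<close> the sums over \<open>j\<close> on the left, \<open>\<parallel>w\<parallel>\<^sup>2\<close> is the sum over \<open>j\<close> of the inner products of \<open>f j\<close> with the
  synthesis of \<open>\<Sum>i\<in>I. w i * a i j\<close>, and the squared norms of these add up to a quadratic form of the
  matrix on the right.
\<close>

lemma sum_L2_inner_synthesis_power2_le:
  assumes I: "finite I" and J: "finite J"
    and f: "\<And>j. j \<in> J \<Longrightarrow> f j \<in> L2 \<mu>"
    and a: "\<And>i j. i \<in> I \<Longrightarrow> j \<in> J \<Longrightarrow> a i j \<in> ell2 E"
  shows "(\<Sum>i\<in>I. (cmod (\<Sum>j\<in>J. L2_inner \<mu> (f j) (synthesis (a i j))))\<^sup>2) \<le>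
    complex_matrix_norm I (\<lambda>i i'. \<Sum>\<^sub>\<infinity>h\<in>E. \<Sum>j\<in>J. a i j h * cnj (a i' j h)) * (\<Sum>j\<in>J. (L2_norm \<mu> (f j))\<^sup>2)"
proof -
  define w where "w i = (\<Sum>j\<in>J. L2_inner \<mu> (f j) (synthesis (a i j)))" for i
  define M where "M = (\<lambda>i i'. \<Sum>\<^sub>\<infinity>h\<in>E. \<Sum>j\<in>J. a i j h * cnj (a i' j h))"
  define b where "b j h = (\<Sum>i\<in>I. w i * a i j h)" for j h
  let ?X = "\<Sum>i\<in>I. (cmod (w i))\<^sup>2" and ?Y = "\<Sum>j\<in>J. (L2_norm \<mu> (f j))\<^sup>2" and ?N = "complex_matrix_norm I M"
  have sq: "(\<lambda>h. (cmod (a i j h))\<^sup>2) summable_on E" if "i \<in> I" "j \<in> J" for i j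
    using a[OF that] by (simp add: ell2_def)
  have b: "(\<lambda>h. (cmod (b j h))\<^sup>2) summable_on E" if "j \<in> J" for j
    using ell2_sum[where I = I and a = "\<lambda>i. a i j" and E = E and c = w] a that
    by (simp add: ell2_def b_def)
  have M: "M i i' = (\<Sum>j\<in>J. \<Sum>\<^sub>\<infinity>h\<in>E. a i j h * cnj (a i' j h))" if "i \<in> I" "i' \<in> I" for i i'
    unfolding M_def using a that by (intro infsumI has_sum_sum has_sum_infsum ell2_mult_cnj_summable)
  have "complex_of_real ?X = (\<Sum>i\<in>I. cnj (w i) * (\<Sum>j\<in>J. L2_inner \<mu> (f j) (synthesis (a i j))))"
    by (simp add: complex_norm_square w_def mult.commute del: of_real_power)
  \<comment> \<open>The factors \<open>cnj (w i)\<close> move into the second argument, where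
    conjugate linearity turns them into \<open>w i\<close>.\<close>
  also have "\<dots> = (\<Sum>j\<in>J. \<Sum>i\<in>I. L2_inner \<mu> (f j) (\<lambda>y. w i * synthesis (a i j) y))"
    by (simp add: sum_distrib_left L2_inner_cmult_right) (rule sum.swap)
  also have "\<dots> = (\<Sum>j\<in>J. L2_inner \<mu> (f j) (synthesis (b j)))"
  proof (rule sum.cong)
    fix j assume j: "j \<in> J"
    have "(\<Sum>i\<in>I. L2_inner \<mu> (f j) (\<lambda>y. w i * synthesis (a i j) y)) =
        L2_inner \<mu> (f j) (\<lambda>y. \<Sum>i\<in>I. w i * synthesis (a i j) y)"
      using j f sq by (intro L2_inner_sum_right[symmetric] L2_cmult synthesis_L2)
    then show "(\<Sum>i\<in>I. L2_inner \<mu> (f j) (\<lambda>y. w i * synthesis (a i j) y)) = L2_inner \<mu> (f j) (synthesis (b j))"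
      unfolding b_def synthesis_sum[symmetric] .
  qed simp
  finally have "?X = cmod (\<Sum>j\<in>J. L2_inner \<mu> (f j) (synthesis (b j)))"
    using norm_of_real[of ?X, where ?'a = complex] by (simp add: sum_nonneg)
  also have "\<dots> \<le> (\<Sum>j\<in>J. \<bar>L2_norm \<mu> (f j)\<bar> * \<bar>L2_norm \<mu> (synthesis (b j))\<bar>)"
    using f b by (intro order.trans[OF norm_sum] sum_mono)
      (simp add: L2_Cauchy_Schwarz synthesis_L2 L2_norm_nonneg)
  also have "\<dots> \<le> sqrt ?Y * sqrt (\<Sum>j\<in>J. (L2_norm \<mu> (synthesis (b j)))\<^sup>2)"
    using L2_set_mult_ineq by (simp add: L2_set_def)
  finally have "?X\<^sup>2 \<le> (sqrt ?Y * sqrt (\<Sum>j\<in>J. (L2_norm \<mu> (synthesis (b j)))\<^sup>2))\<^sup>2"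
    by (intro power_mono) (simp_all add: sum_nonneg)
  then have X: "?X\<^sup>2 \<le> ?Y * (\<Sum>j\<in>J. (L2_norm \<mu> (synthesis (b j)))\<^sup>2)"
    by (simp add: power_mult_distrib sum_nonneg)
  have "complex_of_real (\<Sum>j\<in>J. (L2_norm \<mu> (synthesis (b j)))\<^sup>2) =
      (\<Sum>j\<in>J. \<Sum>i\<in>I. \<Sum>i'\<in>I. w i * cnj (w i') * (\<Sum>\<^sub>\<infinity>h\<in>E. a i j h * cnj (a i' j h)))"
    unfolding of_real_sum using a
    by (intro sum.cong refl) (simp add: synthesis_norm_power2 b, simp add: b_def infsum_power2_cmod_sum)
  also have "\<dots> = (\<Sum>i\<in>I. \<Sum>i'\<in>I. \<Sum>j\<in>J. w i * cnj (w i') * (\<Sum>\<^sub>\<infinity>h\<in>E. a i j h * cnj (a i' j h)))"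
    by (subst sum.swap, rule sum.cong[OF refl], rule sum.swap)
  \<comment> \<open>This is the form of \<open>M\<close> at the conjugate of \<open>w\<close>, a
    vector of the same norm; here the transposition is absorbed.\<close>
  also have "\<dots> = (\<Sum>i\<in>I. (\<Sum>i'\<in>I. M i i' * cnj (w i')) * cnj (cnj (w i)))"
    by (simp add: M sum_distrib_left sum_distrib_right mult_ac cong: sum.cong)
  finally have "(\<Sum>j\<in>J. (L2_norm \<mu> (synthesis (b j)))\<^sup>2) =
      cmod (\<Sum>i\<in>I. (\<Sum>i'\<in>I. M i i' * cnj (w i')) * cnj (cnj (w i)))"
    using norm_of_real[of "\<Sum>j\<in>J. (L2_norm \<mu> (synthesis (b j)))\<^sup>2", where ?'a = complex] by (simp add: sum_nonneg)
  also have "\<dots> \<le> ?N * (\<Sum>i\<in>I. (cmod (cnj (w i)))\<^sup>2)"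
    by (rule complex_matrix_norm_quadratic_form[OF I])
  finally have "?Y * (\<Sum>j\<in>J. (L2_norm \<mu> (synthesis (b j)))\<^sup>2) \<le> ?Y * (?N * ?X)"
    by (intro mult_left_mono) (simp_all add: sum_nonneg)
  with X have "?X * ?X \<le> (?N * ?Y) * ?X"
    by (simp add: power2_eq_square mult_ac)
  moreover have "0 \<le> ?N * ?Y"
    by (intro mult_nonneg_nonneg complex_matrix_norm_nonneg I) (simp add: sum_nonneg)
  \<comment> \<open>One factor \<open>?X\<close> is cancelled; if it is 0, the claim is the
    nonnegativity of the right-hand side.\<close>
  ultimately have "?X \<le> ?N * ?Y"
    using sum_nonneg[of I "\<lambda>i. (cmod (w i))\<^sup>2"] by (cases "?X = 0") (auto simp: mult_le_cancel_right)
  then show ?thesis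
    by (simp add: w_def M_def)
qed

end

section \<open>Norms of operators in the group von Neumann algebra\<close>

text \<open>A closure lies in the underlying set of its topology, and the pullback topology lives on
  \<open>bounded_operators \<mu>\<close>.\<close>

lemma VN_subset_bounded_operators: "T \<in> VN \<mu> \<Longrightarrow> T \<in> bounded_operators \<mu>"
  using closure_of_subset_topspace[of "weak_operator_topology \<mu>"]
  by (auto simp: VN_def weak_operator_topology_def topspace_pullback_topology)

text \<open>The empty combination of translations. It shows that the suprema defining the norms on
  \<open>A(G)\<close> range over nonempty sets.\<close>

lemma zero_operator_VN: "(\<lambda>f y. 0) \<in> VN \<mu>"
proof -
  have "(\<lambda>f y. 0) \<in> bounded_operators \<mu>"
    by (auto simp: bounded_operators_def L2_def L2_norm_def intro!: exI[of _ 0])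
  then have "(\<lambda>f y. 0) \<in> topspace (weak_operator_topology \<mu>)"
    by (auto simp: weak_operator_topology_def topspace_pullback_topology)
  moreover have "(\<lambda>f y. 0) \<in> span_left_regular"
    unfolding span_left_regular_def by (auto intro!: exI[of _ "{}"])
  ultimately show ?thesis
    unfolding VN_def using closure_of_subset_Int by fastforce
qed

lemma bounded_operators_bound:
  assumes "T \<in> bounded_operators \<mu>"
  obtains C where "0 \<le> C" "\<And>f. f \<in> L2 \<mu> \<Longrightarrow> L2_norm \<mu> (T f) \<le> C * L2_norm \<mu> f"
proof -
  obtain C where C: "\<And>f. f \<in> L2 \<mu> \<Longrightarrow> L2_norm \<mu> (T f) \<le> C * L2_norm \<mu> f"
    using assms unfolding bounded_operators_def by blast
  have "L2_norm \<mu> (T f) \<le> \<bar>C\<bar> * L2_norm \<mu> f" if "f \<in> L2 \<mu>" for f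
    using C[OF that] mult_right_mono[OF abs_ge_self L2_norm_nonneg] by (rule order.trans)
  then show ?thesis by (intro that[of "\<bar>C\<bar>"]) auto
qed

lemma operator_norm_upper:
  assumes "T \<in> bounded_operators \<mu>" "f \<in> L2 \<mu>" "L2_norm \<mu> f \<le> 1"
  shows "L2_norm \<mu> (T f) \<le> operator_norm \<mu> T"
proof -
  obtain C where C: "0 \<le> C" "\<And>f. f \<in> L2 \<mu> \<Longrightarrow> L2_norm \<mu> (T f) \<le> C * L2_norm \<mu> f"
    using bounded_operators_bound[OF assms(1)] by blast
  have "bdd_above ((\<lambda>f. L2_norm \<mu> (T f)) ` {f \<in> L2 \<mu>. L2_norm \<mu> f \<le> 1})"
  proof (rule bdd_aboveI2)
    fix f assume "f \<in> {f \<in> L2 \<mu>. L2_norm \<mu> f \<le> 1}"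
    then have "f \<in> L2 \<mu>" "L2_norm \<mu> f \<le> 1" by auto
    then show "L2_norm \<mu> (T f) \<le> C * 1"
      using C mult_left_mono by (meson order.trans)
  qed
  then show ?thesis
    unfolding operator_norm_def using assms by (intro cSUP_upper) auto
qed

text \<open>Makes \<open>operator_matrix_norm\<close> dominate the value at each vector of the unit
  ball. Only finiteness matters, so bounds for the separate entries suffice.\<close>

lemma bdd_above_operator_matrix_norm:
  fixes m :: nat
  assumes T: "\<And>k l. k < m \<Longrightarrow> l < m \<Longrightarrow> T k l \<in> bounded_operators \<mu>"
  shows "bdd_above ((\<lambda>f. sqrt (\<Sum>k<m. (L2_norm \<mu> (\<lambda>x. \<Sum>l<m. T k l (f l) x))\<^sup>2)) `
    {f. (\<forall>l<m. f l \<in> L2 \<mu>) \<and> (\<Sum>l<m. (L2_norm \<mu> (f l))\<^sup>2) \<le> 1})"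
proof -
  have "\<forall>k l. \<exists>C. k < m \<longrightarrow> l < m \<longrightarrow> 0 \<le> C \<and> (\<forall>f\<in>L2 \<mu>. L2_norm \<mu> (T k l f) \<le> C * L2_norm \<mu> f)"
    using bounded_operators_bound[OF T] by metis
  then obtain C where C: "\<And>k l. k < m \<Longrightarrow> l < m \<Longrightarrow> 0 \<le> C k l"
    "\<And>k l f. k < m \<Longrightarrow> l < m \<Longrightarrow> f \<in> L2 \<mu> \<Longrightarrow> L2_norm \<mu> (T k l f) \<le> C k l * L2_norm \<mu> f"
    by metis
  show ?thesis
  proof (rule bdd_aboveI2)
    fix f assume "f \<in> {f. (\<forall>l<m. f l \<in> L2 \<mu>) \<and> (\<Sum>l<m. (L2_norm \<mu> (f l))\<^sup>2) \<le> 1}"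
    then have f: "\<And>l. l < m \<Longrightarrow> f l \<in> L2 \<mu>" and f1: "(\<Sum>l<m. (L2_norm \<mu> (f l))\<^sup>2) \<le> 1" by auto
    have norm1: "L2_norm \<mu> (f l) \<le> 1" if "l < m" for l
    proof -
      have "(L2_norm \<mu> (f l))\<^sup>2 \<le> 1"
        by (rule order.trans[OF member_le_sum[of l "{..<m}" "\<lambda>l. (L2_norm \<mu> (f l))\<^sup>2"] f1]) (use that in auto)
      then show ?thesis
        using L2_norm_nonneg[of \<mu> "f l"] by (simp add: abs_square_le_1)
    qed
    have "(L2_norm \<mu> (\<lambda>x. \<Sum>l<m. T k l (f l) x))\<^sup>2 \<le> m * (\<Sum>l<m. (C k l)\<^sup>2)" if k: "k < m" for k
    proof -
      have "(L2_norm \<mu> (\<lambda>x. \<Sum>l<m. T k l (f l) x))\<^sup>2 \<le> of_nat (card {..<m}) * (\<Sum>l<m. (L2_norm \<mu> (T k l (f l)))\<^sup>2)"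
        using T[OF k] f by (intro L2_norm_sum_power2_le) (auto simp: bounded_operators_def)
      also have "\<dots> \<le> of_nat (card {..<m}) * (\<Sum>l<m. (C k l)\<^sup>2)"
      proof (intro mult_left_mono sum_mono power_mono)
        fix l assume "l \<in> {..<m}"
        then have l: "l < m" by simp
        have "L2_norm \<mu> (T k l (f l)) \<le> C k l * L2_norm \<mu> (f l)"
          using C(2)[OF k l f[OF l]] .
        also have "\<dots> \<le> C k l * 1"
          using C(1)[OF k l] norm1[OF l] by (intro mult_left_mono)
        finally show "L2_norm \<mu> (T k l (f l)) \<le> C k l" by simp
      qed (auto simp: L2_norm_nonneg)
      finally show ?thesis by simp
    qed
    then show "sqrt (\<Sum>k<m. (L2_norm \<mu> (\<lambda>x. \<Sum>l<m. T k l (f l) x))\<^sup>2) \<le> sqrt (\<Sum>k<m. m * (\<Sum>l<m. (C k l)\<^sup>2))"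
      by (intro real_sqrt_le_mono sum_mono) auto
  qed
qed

text \<open>Homogeneity again, now for a seminorm and for operators that are linear only up to null
  sets.\<close>

lemma operator_matrix_contractive:
  assumes T: "\<And>k l. k < m \<Longrightarrow> l < m \<Longrightarrow> T k l \<in> bounded_operators \<mu>"
    and le1: "operator_matrix_norm \<mu> m T \<le> 1"
    and f: "\<And>l. l < m \<Longrightarrow> f l \<in> L2 \<mu>"
  shows "(\<Sum>k<m. (L2_norm \<mu> (\<lambda>x. \<Sum>l<m. T k l (f l) x))\<^sup>2) \<le> (\<Sum>l<m. (L2_norm \<mu> (f l))\<^sup>2)"
proof (rule field_le_epsilon)
  fix d :: real assume d: "0 < d"
  let ?S = "\<Sum>l<m. (L2_norm \<mu> (f l))\<^sup>2"
  \<comment> \<open>The slack \<open>d\<close> keeps \<open>r\<close> positive even if all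
    \<open>f l\<close> are null; it disappears through \<open>field_le_epsilon\<close>.\<close>
  define r where "r = sqrt (?S + d)"
  have "0 < ?S + d"
    using d by (intro add_nonneg_pos) (auto simp: sum_nonneg)
  then have r: "0 < r" "r\<^sup>2 = ?S + d" by (auto simp: r_def)
  define c where "c = complex_of_real (1 / r)"
  have cm: "cmod c = 1 / r" unfolding c_def norm_of_real using r by simp
  have "(\<Sum>l<m. (L2_norm \<mu> (\<lambda>x. c * f l x))\<^sup>2) = ?S / r\<^sup>2"
    by (simp add: L2_norm_cmult cm power_mult_distrib power_divide sum_divide_distrib)
  also have "\<dots> \<le> 1"
  proof -
    have "?S \<le> r\<^sup>2" using r(2) d by linarith
    then show ?thesis using r(1) by (simp add: divide_le_eq)
  qed
  finally have "sqrt (\<Sum>k<m. (L2_norm \<mu> (\<lambda>x. \<Sum>l<m. T k l (\<lambda>x. c * f l x) x))\<^sup>2) \<le> operator_matrix_norm \<mu> m T"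
    unfolding operator_matrix_norm_def using f
    by (intro cSUP_upper[where f = "\<lambda>f. sqrt (\<Sum>k<m. (L2_norm \<mu> (\<lambda>x. \<Sum>l<m. T k l (f l) x))\<^sup>2)" and x = "\<lambda>l x. c * f l x"]
        bdd_above_operator_matrix_norm T) (auto intro: L2_cmult)
  also note le1
  finally have "(\<Sum>k<m. (L2_norm \<mu> (\<lambda>x. \<Sum>l<m. T k l (\<lambda>x. c * f l x) x))\<^sup>2) \<le> 1"
    by simp
  moreover have "L2_norm \<mu> (\<lambda>x. \<Sum>l<m. T k l (\<lambda>x. c * f l x) x) = (1 / r) * L2_norm \<mu> (\<lambda>x. \<Sum>l<m. T k l (f l) x)"
    if k: "k < m" for k
  proof -
    have TL: "T k l (f l) \<in> L2 \<mu>" "T k l (\<lambda>x. c * f l x) \<in> L2 \<mu>"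
      "AE x in \<mu>. T k l (\<lambda>x. c * f l x) x = c * T k l (f l) x" if "l < m" for l
      using T[OF k that] f[OF that] L2_cmult[OF f[OF that], of c] by (auto simp: bounded_operators_def)
    \<comment> \<open>The exceptional null sets of the finitely many \<open>l\<close> are united
      into one.\<close>
    have "AE x in \<mu>. \<forall>l\<in>{..<m}. T k l (\<lambda>x. c * f l x) x = c * T k l (f l) x"
      using TL(3) by (intro AE_finite_allI) auto
    then have "AE x in \<mu>. (\<Sum>l<m. T k l (\<lambda>x. c * f l x) x) = c * (\<Sum>l<m. T k l (f l) x)"
      by eventually_elim (simp add: sum_distrib_left)
    then have "L2_norm \<mu> (\<lambda>x. \<Sum>l<m. T k l (\<lambda>x. c * f l x) x) = L2_norm \<mu> (\<lambda>x. c * (\<Sum>l<m. T k l (f l) x))"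
      using TL by (intro L2_norm_cong_AE) (auto intro!: L2_measurable L2_cmult L2_sum)
    then show ?thesis by (simp add: L2_norm_cmult cm)
  qed
  ultimately have "(\<Sum>k<m. (L2_norm \<mu> (\<lambda>x. \<Sum>l<m. T k l (f l) x))\<^sup>2) / r\<^sup>2 \<le> 1"
    by (simp add: power_divide sum_divide_distrib)
  then show "(\<Sum>k<m. (L2_norm \<mu> (\<lambda>x. \<Sum>l<m. T k l (f l) x))\<^sup>2) \<le> ?S + d"
    unfolding r(2)[symmetric] using r(1) by (simp add: divide_le_eq)
qed

section \<open>Haar measure\<close>

lemma space_haar: "left_haar_measure \<mu> \<Longrightarrow> space \<mu> = UNIV"
  using sets_eq_imp_space_eq[of \<mu> borel] by (simp add: left_haar_measure_def)

lemma measurable_translation: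
  fixes \<mu> :: "'a::{topological_group_add, t2_space} measure"
  assumes "left_haar_measure \<mu>"
  shows "(\<lambda>y. x + y) \<in> measurable \<mu> \<mu>"
proof -
  have sets: "sets \<mu> = sets borel" using assms by (simp add: left_haar_measure_def)
  have "(\<lambda>y. x + y) \<in> measurable borel borel"
    by (intro borel_measurable_continuous_onI continuous_intros)
  then show ?thesis
    using measurable_cong_sets[OF sets sets] by simp
qed

text \<open>Left invariance as an identity of push-forward measures, the form needed for changes of
  variables in integrals.\<close>

lemma distr_translation:
  fixes \<mu> :: "'a::{topological_group_add, t2_space} measure"
  assumes haar: "left_haar_measure \<mu>"
  shows "distr \<mu> \<mu> (\<lambda>y. x + y) = \<mu>"
proof (rule measure_eqI)
  have sets: "sets \<mu> = sets borel" using haar by (simp add: left_haar_measure_def)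
  fix A assume "A \<in> sets (distr \<mu> \<mu> (\<lambda>y. x + y))"
  then have A: "A \<in> sets \<mu>" by simp
  have "(\<lambda>y. x + y) -` A = (\<lambda>y. - x + y) ` A"
    by (force simp: image_iff add.assoc[symmetric])
  moreover have "emeasure \<mu> ((\<lambda>y. - x + y) ` A) = emeasure \<mu> A"
    using haar A sets unfolding left_haar_measure_def by blast
  ultimately show "emeasure (distr \<mu> \<mu> (\<lambda>y. x + y)) A = emeasure \<mu> A"
    using A by (simp add: emeasure_distr measurable_translation[OF haar] space_haar[OF haar])
qed simp

lemma L2_inner_left_regular:
  fixes \<mu> :: "'a::{topological_group_add, t2_space} measure"
  assumes haar: "left_haar_measure \<mu>" and "f \<in> L2 \<mu>" "g \<in> L2 \<mu>"
  shows "L2_inner \<mu> (left_regular x f) (left_regular x g) = L2_inner \<mu> f g"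
  using integral_distr[OF measurable_translation[OF haar, of "- x"], of "\<lambda>y. f y * cnj (g y)"]
    L2_mult_cnj_integrable[OF assms(2,3)]
  by (simp add: L2_inner_def left_regular_def distr_translation[OF haar] borel_measurable_integrable)

lemma L2_norm_left_regular:
  fixes \<mu> :: "'a::{topological_group_add, t2_space} measure"
  assumes haar: "left_haar_measure \<mu>" and "f \<in> L2 \<mu>"
  shows "L2_norm \<mu> (left_regular x f) = L2_norm \<mu> f"
  using integral_distr[OF measurable_translation[OF haar, of "- x"], of "\<lambda>y. (cmod (f y))\<^sup>2"] assms(2)
  by (simp add: L2_norm_def left_regular_def distr_translation[OF haar] L2_def borel_measurable_integrable)

lemma left_regular_add: "left_regular x (left_regular y f) = left_regular (x + y) f"
  by (simp add: left_regular_def minus_add add.assoc del: add_uminus_conv_diff)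

text \<open>Finitely many translates of a null open set cover any given compact set, which is
  therefore null; inner regularity on the whole group then contradicts that the measure is
  nonzero.\<close>

lemma emeasure_open_pos:
  fixes \<mu> :: "'a::{topological_group_add, t2_space} measure"
  assumes haar: "left_haar_measure \<mu>" and W: "open W" "W \<noteq> {}"
  shows "emeasure \<mu> W \<noteq> 0"
proof
  assume null: "emeasure \<mu> W = 0"
  have sets: "sets \<mu> = sets borel" using haar by (simp add: left_haar_measure_def)
  obtain w where w: "w \<in> W" using W by blast
  \<comment> \<open>The left translate of \<open>W\<close> that carries \<open>w\<close> to
    \<open>x\<close>, hence an open neighbourhood of \<open>x\<close>.\<close>
  let ?t = "\<lambda>x. (\<lambda>y. x - w + y) ` W"
  have "?t x = (\<lambda>y. w - x + y) -` W" for x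
  proof -
    have "w - x + (x - w + y) = y" "x - w + (w - x + y) = y" for y
      by (simp_all add: diff_conv_add_uminus add.assoc del: add_uminus_conv_diff)
    then show ?thesis
      by (auto intro: image_eqI[of _ _ "w - x + _"])
  qed
  then have op: "open (?t x)" for x
    using W(1) by (simp, intro open_vimage continuous_intros)
  have "emeasure \<mu> (?t x) = 0" for x
    using haar null W(1) by (simp add: left_haar_measure_def)
  then have t_null: "?t x \<in> null_sets \<mu>" for x
    using op[of x] sets by (simp add: null_sets_def)
  have "emeasure \<mu> K = 0" if K: "compact K" for K
  proof -
    have "K \<subseteq> (\<Union>x\<in>K. ?t x)"
      using w by (force simp: image_iff intro: bexI[of _ w])
    then obtain C where C: "C \<subseteq> K" "finite C" "K \<subseteq> (\<Union>x\<in>C. ?t x)"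
      using compactE_image[OF K, of K ?t] op by blast
    have "(\<Union>x\<in>C. ?t x) \<in> null_sets \<mu>"
      using t_null C(2) by (intro null_sets_UN' countable_finite)
    moreover have "K \<in> sets \<mu>"
      using borel_closed[OF compact_imp_closed[OF K]] sets by simp
    ultimately show ?thesis
      using C(3) null_sets_subset by blast
  qed
  then have "(SUP K\<in>{K. compact K \<and> K \<subseteq> UNIV}. emeasure \<mu> K) = 0"
    by (auto intro!: SUP_eq_const[THEN trans])
  moreover have "emeasure \<mu> UNIV = (SUP K\<in>{K. compact K \<and> K \<subseteq> UNIV}. emeasure \<mu> K)" "emeasure \<mu> UNIV \<noteq> 0"
    using haar open_UNIV unfolding left_haar_measure_def by blast+
  ultimately show False by simp
qed

lemma L2_norm_indicator: "L2_norm \<mu> (indicator A) = sqrt (measure \<mu> (A \<inter> space \<mu>))"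
proof -
  have "(\<lambda>x. (cmod (indicator A x))\<^sup>2) = indicator A"
    by (auto simp: indicator_def)
  then show ?thesis
    by (simp add: L2_norm_def)
qed

section \<open>The map into the Fourier algebra\<close>

text \<open>Collects the properties of \<xi> on which the estimates rest; its form as a normalized
  indicator serves to verify them.\<close>

locale disjoint_translates =
  fixes \<mu> :: "'a::{topological_group_add, t2_space} measure" and E :: "'a set" and \<xi> :: "'a \<Rightarrow> complex"
  assumes haar: "left_haar_measure \<mu>"
    and window: "\<xi> \<in> L2 \<mu>" "L2_norm \<mu> \<xi> = 1"
    and disjoint: "h \<in> E \<Longrightarrow> k \<in> E \<Longrightarrow> h \<noteq> k \<Longrightarrow> \<xi> (- h + y) = 0 \<or> \<xi> (- k + y) = 0"
begin

sublocale disjoint_family_L2 \<mu> E "\<lambda>h. left_regular h \<xi>"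
proof
  show "left_regular h \<xi> y = 0 \<or> left_regular k \<xi> y = 0" if "h \<in> E" "k \<in> E" "h \<noteq> k" for h k y
    using disjoint[OF that] by (simp add: left_regular_def)
qed (simp_all add: left_regular_L2[OF haar] L2_norm_left_regular[OF haar] window)

abbreviation Gamma :: "('a \<Rightarrow> complex) \<Rightarrow> 'a \<Rightarrow> complex" where
  "Gamma \<equiv> Gamma_map E (coefficient \<mu> \<xi> \<xi>)"

text \<open>The vector called \<open>g \<phi>\<close> in the overview. The coefficients are
  conjugated because it stands in the second argument of inner products.\<close>

abbreviation symbol :: "('a \<Rightarrow> complex) \<Rightarrow> 'a \<Rightarrow> complex" where
  "symbol \<phi> \<equiv> synthesis (\<lambda>h. cnj (\<phi> h))"

text \<open>Unitarity of \<open>left_regular h\<close> moves the translation by \<open>- h\<close>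
  to the second vector.\<close>

lemma translate_coefficient:
  "translate h (coefficient \<mu> \<xi> \<xi>) x = L2_inner \<mu> (left_regular x \<xi>) (left_regular h \<xi>)"
proof -
  have "L2_inner \<mu> (left_regular (- h + x) \<xi>) \<xi> =
      L2_inner \<mu> (left_regular h (left_regular (- h + x) \<xi>)) (left_regular h \<xi>)"
    by (intro L2_inner_left_regular[OF haar, symmetric] left_regular_L2[OF haar] window)
  then show ?thesis
    by (simp add: translate_def coefficient_def left_regular_add add.assoc[symmetric])
qed

lemma symbol_L2: "\<phi> \<in> ell2 E \<Longrightarrow> symbol \<phi> \<in> L2 \<mu>"
  by (rule synthesis_L2) (simp add: ell2_def)

lemma L2_norm_symbol:
  assumes "\<phi> \<in> ell2 E"
  shows "L2_norm \<mu> (symbol \<phi>) = ell2_norm E \<phi>"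
proof -
  have "(L2_norm \<mu> (symbol \<phi>))\<^sup>2 = (\<Sum>\<^sub>\<infinity>h\<in>E. (cmod (\<phi> h))\<^sup>2)"
    using synthesis_norm_power2[of "\<lambda>h. cnj (\<phi> h)"] assms by (simp add: ell2_def)
  then show ?thesis
    unfolding ell2_norm_def using L2_norm_nonneg by (metis real_sqrt_unique)
qed

lemma Gamma_eq_coefficient:
  assumes "\<phi> \<in> ell2 E"
  shows "Gamma \<phi> = coefficient \<mu> \<xi> (symbol \<phi>)"
proof
  fix x
  have "((\<lambda>h. cnj (cnj (\<phi> h)) * L2_inner \<mu> (left_regular x \<xi>) (left_regular h \<xi>)) has_sum
      L2_inner \<mu> (left_regular x \<xi>) (symbol \<phi>)) E"
    using assms by (intro L2_inner_synthesis left_regular_L2[OF haar] window) (simp add: ell2_def)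
  then show "Gamma \<phi> x = coefficient \<mu> \<xi> (symbol \<phi>) x"
    unfolding Gamma_map_def translate_coefficient by (simp add: coefficient_def infsumI)
qed

lemma Gamma_restrict:
  assumes "x \<in> E"
  shows "Gamma \<phi> x = \<phi> x"
proof -
  have "Gamma \<phi> x = (\<Sum>\<^sub>\<infinity>h\<in>{x}. \<phi> h)"
    unfolding Gamma_map_def translate_coefficient
    using assms L2_inner_family[OF assms] by (intro infsum_cong_neutral) auto
  then show ?thesis by simp
qed

text \<open>\<open>symbol\<close> is conjugate linear, as is the inner product in its second
  argument, so the two conjugations cancel.\<close>

lemma linear_map_Gamma: "linear_map_between (ell2 E) (fourier_algebra \<mu>) Gamma"
  unfolding linear_map_between_def
proof (intro conjI ballI allI)
  fix \<phi> assume "\<phi> \<in> ell2 E"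
  then show "Gamma \<phi> \<in> fourier_algebra \<mu>"
    unfolding fourier_algebra_def using Gamma_eq_coefficient symbol_L2 window(1) by blast
next
  fix \<phi> \<psi> assume *: "\<phi> \<in> ell2 E" "\<psi> \<in> ell2 E"
  have "symbol (\<lambda>h. \<phi> h + \<psi> h) = (\<lambda>y. symbol \<phi> y + symbol \<psi> y)"
    by (simp add: synthesis_add fun_eq_iff)
  then show "Gamma (\<lambda>h. \<phi> h + \<psi> h) = (\<lambda>x. Gamma \<phi> x + Gamma \<psi> x)"
    unfolding Gamma_eq_coefficient[OF *(1)] Gamma_eq_coefficient[OF *(2)] Gamma_eq_coefficient[OF ell2_add[OF *]]
    using * by (simp add: coefficient_def L2_inner_add_right left_regular_L2[OF haar] window symbol_L2)
next
  fix c \<phi> assume *: "\<phi> \<in> ell2 E"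
  have "symbol (\<lambda>h. c * \<phi> h) = (\<lambda>y. cnj c * symbol \<phi> y)"
    using synthesis_sum[where I = "{()}" and c = "\<lambda>_. cnj c" and a = "\<lambda>_ h. cnj (\<phi> h)"] by (simp add: fun_eq_iff)
  then show "Gamma (\<lambda>h. c * \<phi> h) = (\<lambda>x. c * Gamma \<phi> x)"
    unfolding Gamma_eq_coefficient[OF *] Gamma_eq_coefficient[OF ell2_cmult[OF *]]
    by (simp add: coefficient_def L2_inner_cmult_right)
qed

lemma VN_pairing_Gamma:
  assumes "T \<in> VN \<mu>" "\<phi> \<in> ell2 E"
  shows "VN_pairing \<mu> T (Gamma \<phi>) = L2_inner \<mu> (T \<xi>) (symbol \<phi>)"
  using assms by (simp add: Gamma_eq_coefficient VN_pairing_coefficient[OF haar] window symbol_L2)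

text \<open>The pairing is the inner product of \<open>T \<xi>\<close> with
  \<open>symbol \<phi>\<close>; Cauchy-Schwarz applies, with \<open>T \<xi>\<close> of norm at most
  1.\<close>

lemma fourier_norm_Gamma_le:
  assumes "\<phi> \<in> ell2 E"
  shows "fourier_norm \<mu> (Gamma \<phi>) \<le> ell2_norm E \<phi>"
  unfolding fourier_norm_def
proof (rule cSUP_least)
  \<comment> \<open>The zero operator witnesses nonemptiness; its norm is a supremum of zeros over a
    set that contains \<xi>.\<close>
  have "operator_norm \<mu> (\<lambda>f y. 0) = (SUP f\<in>{f \<in> L2 \<mu>. L2_norm \<mu> f \<le> 1}. 0)"
    by (simp add: operator_norm_def L2_norm_def)
  also have "\<dots> = 0"
    using window by (intro cSUP_const) auto
  finally show "{T \<in> VN \<mu>. operator_norm \<mu> T \<le> 1} \<noteq> {}"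
    using zero_operator_VN[of \<mu>] by (intro ex_in_conv[THEN iffD1]) (auto intro!: exI[of _ "\<lambda>f y. 0"])
next
  fix T assume "T \<in> {T \<in> VN \<mu>. operator_norm \<mu> T \<le> 1}"
  then have T: "T \<in> VN \<mu>" "T \<in> bounded_operators \<mu>" "operator_norm \<mu> T \<le> 1"
    by (auto intro: VN_subset_bounded_operators)
  have "T \<xi> \<in> L2 \<mu>"
    using T(2) window(1) by (auto simp: bounded_operators_def)
  then have "cmod (VN_pairing \<mu> T (Gamma \<phi>)) \<le> L2_norm \<mu> (T \<xi>) * L2_norm \<mu> (symbol \<phi>)"
    using assms T by (simp add: VN_pairing_Gamma L2_Cauchy_Schwarz symbol_L2)
  also have "\<dots> \<le> 1 * L2_norm \<mu> (symbol \<phi>)"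
    using operator_norm_upper[OF T(2) window(1)] T(3) window(2)
    by (intro mult_right_mono L2_norm_nonneg) linarith
  finally show "cmod (VN_pairing \<mu> T (Gamma \<phi>)) \<le> ell2_norm E \<phi>"
    using assms by (simp add: L2_norm_symbol)
qed

text \<open>Two estimates are combined: the row estimate over \<open>j\<close> for each fixed
  \<open>k\<close>, and contractivity of \<open>[T k l]\<close> for each fixed
  \<open>j\<close>.\<close>

lemma fourier_matrix_norm_Gamma_le:
  assumes \<phi>: "\<And>i j. i < n \<Longrightarrow> j < n \<Longrightarrow> \<phi> i j \<in> ell2 E"
  shows "fourier_matrix_norm \<mu> n (\<lambda>i j. Gamma (\<phi> i j)) \<le>
    conjugate_matrix_norm (ell2_row_matrix_norm E) n \<phi>"
  unfolding fourier_matrix_norm_def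
proof (rule cSUP_least)
  have "operator_matrix_norm \<mu> 1 (\<lambda>k l f y. 0) =
      (SUP f\<in>{f. (\<forall>l<1::nat. f l \<in> L2 \<mu>) \<and> (\<Sum>l<1. (L2_norm \<mu> (f l))\<^sup>2) \<le> 1}. 0)"
    by (simp add: operator_matrix_norm_def L2_norm_def)
  also have "\<dots> = 0"
    using window by (intro cSUP_const ex_in_conv[THEN iffD1]) (auto intro!: exI[of _ "\<lambda>_. \<xi>"])
  finally show "{(m, T). 1 \<le> m \<and> (\<forall>k<m. \<forall>l<m. T k l \<in> VN \<mu>) \<and> operator_matrix_norm \<mu> m T \<le> 1} \<noteq> {}"
    using zero_operator_VN[of \<mu>]
    by (intro ex_in_conv[THEN iffD1] exI[of _ "(1, \<lambda>k l f y. 0)"]) auto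
next
  \<comment> \<open>The matrix of the row estimate for the conjugated coefficients from which
    \<open>symbol\<close> is synthesized; undoing the double conjugation gives the conjugate row
    norm.\<close>
  define N where "N = complex_matrix_norm {..<n} (\<lambda>i i'. \<Sum>\<^sub>\<infinity>h\<in>E. \<Sum>j<n. cnj (\<phi> i j h) * cnj (cnj (\<phi> i' j h)))"
  have norm_eq: "conjugate_matrix_norm (ell2_row_matrix_norm E) n \<phi> = sqrt N"
    by (simp add: conjugate_matrix_norm_def ell2_row_matrix_norm_def N_def)
  have N0: "0 \<le> N"
    unfolding N_def by (rule complex_matrix_norm_nonneg) simp
  fix mT assume "mT \<in> {(m, T). 1 \<le> m \<and> (\<forall>k<m. \<forall>l<m. T k l \<in> VN \<mu>) \<and> operator_matrix_norm \<mu> m T \<le> 1}"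
  then obtain m T where mT: "mT = (m, T)"
    and T: "\<And>k l. k < m \<Longrightarrow> l < m \<Longrightarrow> T k l \<in> VN \<mu>" and le1: "operator_matrix_norm \<mu> m T \<le> 1"
    by auto
  have Tb: "T k l \<in> bounded_operators \<mu>" if "k < m" "l < m" for k l
    using T[OF that] by (rule VN_subset_bounded_operators)
  have "complex_matrix_norm ({..<m} \<times> {..<n}) (\<lambda>(k, i) (l, j). VN_pairing \<mu> (T k l) (Gamma (\<phi> i j))) \<le> sqrt N"
    unfolding complex_matrix_norm_def
  proof (rule cSUP_least)
    show "{v. (\<Sum>p\<in>{..<m} \<times> {..<n}. (cmod (v p))\<^sup>2) \<le> 1} \<noteq> {}"
      by (auto intro!: ex_in_conv[THEN iffD1] exI[of _ "\<lambda>_. 0"])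
  next
    fix v :: "nat \<times> nat \<Rightarrow> complex"
    assume "v \<in> {v. (\<Sum>p\<in>{..<m} \<times> {..<n}. (cmod (v p))\<^sup>2) \<le> 1}"
    then have "(\<Sum>p\<in>{..<m} \<times> {..<n}. (cmod (v p))\<^sup>2) \<le> 1" by simp
    \<comment> \<open>The sum over \<open>j\<close> is put outside because, for fixed
      \<open>j\<close>, the scalars \<open>v (l, j)\<close> weight the inputs of the operator
      matrix.\<close>
    then have v: "(\<Sum>j<n. \<Sum>l<m. (cmod (v (l, j)))\<^sup>2) \<le> 1"
      by (subst sum.swap) (simp add: sum.cartesian_product case_prod_unfold)
    define f where "f k j = (\<lambda>x. \<Sum>l<m. T k l (\<lambda>y. v (l, j) * \<xi> y) x)" for k j
    have TL: "T k l (\<lambda>y. c * \<xi> y) \<in> L2 \<mu>" "T k l \<xi> \<in> L2 \<mu>"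
      "AE x in \<mu>. T k l (\<lambda>y. c * \<xi> y) x = c * T k l \<xi> x" if "k < m" "l < m" for k l c
      using Tb[OF that] L2_cmult window(1) by (auto simp: bounded_operators_def)
    have f: "f k j \<in> L2 \<mu>" if "k < m" for k j
      unfolding f_def using TL that by (intro L2_sum) auto
    have entry: "(\<Sum>q\<in>{..<m} \<times> {..<n}. (case q of (l, j) \<Rightarrow> VN_pairing \<mu> (T k l) (Gamma (\<phi> i j))) * v q) =
        (\<Sum>j<n. L2_inner \<mu> (f k j) (symbol (\<phi> i j)))" if k: "k < m" and i: "i < n" for k i
    proof -
      have "VN_pairing \<mu> (T k l) (Gamma (\<phi> i j)) * v (l, j) =
          L2_inner \<mu> (T k l (\<lambda>y. v (l, j) * \<xi> y)) (symbol (\<phi> i j))" if l: "l < m" and j: "j < n" for l j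
      proof -
        \<comment> \<open>Homogeneity of \<open>T k l\<close> holds only almost everywhere, which
          inner products do not notice.\<close>
        have "L2_inner \<mu> (T k l (\<lambda>y. v (l, j) * \<xi> y)) (symbol (\<phi> i j)) =
            L2_inner \<mu> (\<lambda>x. v (l, j) * T k l \<xi> x) (symbol (\<phi> i j))"
          by (intro L2_inner_cong_AE TL k l L2_cmult symbol_L2 \<phi> i j)
        then show ?thesis
          using T[OF k l] \<phi>[OF i j] by (simp add: VN_pairing_Gamma L2_inner_cmult_left mult.commute)
      qed
      then have "(\<Sum>q\<in>{..<m} \<times> {..<n}. (case q of (l, j) \<Rightarrow> VN_pairing \<mu> (T k l) (Gamma (\<phi> i j))) * v q) =
          (\<Sum>l<m. \<Sum>j<n. L2_inner \<mu> (T k l (\<lambda>y. v (l, j) * \<xi> y)) (symbol (\<phi> i j)))"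
        unfolding sum.cartesian_product by (intro sum.cong) auto
      also have "\<dots> = (\<Sum>j<n. \<Sum>l<m. L2_inner \<mu> (T k l (\<lambda>y. v (l, j) * \<xi> y)) (symbol (\<phi> i j)))"
        by (rule sum.swap)
      also have "\<dots> = (\<Sum>j<n. L2_inner \<mu> (f k j) (symbol (\<phi> i j)))"
        unfolding f_def using TL k i \<phi>
        by (intro sum.cong refl L2_inner_sum_left[symmetric] symbol_L2) auto
      finally show ?thesis .
    qed
    have "(\<Sum>p\<in>{..<m} \<times> {..<n}. (cmod (\<Sum>q\<in>{..<m} \<times> {..<n}.
          (case p of (k, i) \<Rightarrow> \<lambda>(l, j). VN_pairing \<mu> (T k l) (Gamma (\<phi> i j))) q * v q))\<^sup>2) =
        (\<Sum>k<m. \<Sum>i<n. (cmod (\<Sum>j<n. L2_inner \<mu> (f k j) (symbol (\<phi> i j))))\<^sup>2)"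
      unfolding sum.cartesian_product by (intro sum.cong) (auto simp: entry)
    \<comment> \<open>The row estimate, with the same constant \<open>N\<close> for every
      \<open>k\<close>.\<close>
    also have "\<dots> \<le> (\<Sum>k<m. N * (\<Sum>j<n. (L2_norm \<mu> (f k j))\<^sup>2))"
      unfolding N_def using f \<phi>
      by (intro sum_mono sum_L2_inner_synthesis_power2_le) (auto intro: ell2_cnj)
    also have "\<dots> = N * (\<Sum>j<n. \<Sum>k<m. (L2_norm \<mu> (f k j))\<^sup>2)"
      unfolding sum_distrib_left by (rule sum.swap)
    \<comment> \<open>For each \<open>j\<close>, the contraction \<open>[T k l]\<close> acts on the
      column of vectors \<open>v (l, j)\<close> times \<xi>.\<close>
    also have "\<dots> \<le> N * (\<Sum>j<n. \<Sum>l<m. (L2_norm \<mu> (\<lambda>y. v (l, j) * \<xi> y))\<^sup>2)"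
      unfolding f_def by (intro mult_left_mono sum_mono operator_matrix_contractive Tb le1 L2_cmult window N0)
    also have "\<dots> = N * (\<Sum>j<n. \<Sum>l<m. (cmod (v (l, j)))\<^sup>2)"
      by (simp add: L2_norm_cmult window)
    also have "\<dots> \<le> N * 1"
      by (intro mult_left_mono v N0)
    finally show "sqrt (\<Sum>p\<in>{..<m} \<times> {..<n}. (cmod (\<Sum>q\<in>{..<m} \<times> {..<n}.
        (case p of (k, i) \<Rightarrow> \<lambda>(l, j). VN_pairing \<mu> (T k l) (Gamma (\<phi> i j))) q * v q))\<^sup>2) \<le> sqrt N"
      by simp
  qed
  then show "(case mT of (m, T) \<Rightarrow> complex_matrix_norm ({..<m} \<times> {..<n})
      (\<lambda>(k, i) (l, j). VN_pairing \<mu> (T k l) (Gamma (\<phi> i j)))) \<le> conjugate_matrix_norm (ell2_row_matrix_norm E) n \<phi>"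
    by (simp add: mT norm_eq)
qed

end

text \<open>The normalizing constant is nonzero because \<open>V\<close> has nonempty interior and
  finite because \<open>V\<close> lies in a compact set.\<close>

lemma normalized_indicator_window:
  fixes \<mu> :: "'a::{topological_group_add, t2_space} measure"
  assumes haar: "left_haar_measure \<mu>"
    and V: "interior V \<noteq> {}" "V \<in> sets \<mu>" "compact (closure V)"
    and \<xi>: "\<xi> = (\<lambda>x. indicator V x / complex_of_real (L2_norm \<mu> (indicator V)))"
  shows "\<xi> \<in> L2 \<mu>" "L2_norm \<mu> \<xi> = 1"
proof -
  let ?r = "L2_norm \<mu> (indicator V)"
  have sets: "sets \<mu> = sets borel" using haar by (simp add: left_haar_measure_def)
  have "emeasure \<mu> V \<le> emeasure \<mu> (closure V)"
    using sets by (intro emeasure_mono closure_subset) auto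
  also have "\<dots> < \<infinity>"
    using haar V(3) unfolding left_haar_measure_def by blast
  finally have fin: "emeasure \<mu> V < \<infinity>" .
  have "emeasure \<mu> (interior V) \<noteq> 0"
    using V(1) by (intro emeasure_open_pos[OF haar]) auto
  moreover have "emeasure \<mu> (interior V) \<le> emeasure \<mu> V"
    using V(2) by (intro emeasure_mono interior_subset)
  ultimately have "0 < emeasure \<mu> V"
    by (auto simp: zero_less_iff_neq_zero)
  with fin have "0 < measure \<mu> V"
    by (simp add: measure_def enn2real_positive_iff)
  then have r: "0 < ?r"
    by (simp add: L2_norm_indicator space_haar[OF haar])
  have ind: "indicator V \<in> L2 \<mu>"
  proof -
    have "(\<lambda>x. (cmod (indicator V x))\<^sup>2) = (indicator V :: _ \<Rightarrow> real)"
      by (auto simp: indicator_def)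
    then show ?thesis
      using V(2) fin by (simp add: L2_def)
  qed
  have \<xi>': "\<xi> = (\<lambda>x. complex_of_real (1 / ?r) * indicator V x)"
    by (simp add: \<xi>)
  show "\<xi> \<in> L2 \<mu>"
    unfolding \<xi>' by (intro L2_cmult ind)
  show "L2_norm \<mu> \<xi> = 1"
    unfolding \<xi>' L2_norm_cmult norm_of_real using r by simp
qed

theorem theorem3p3:
  fixes \<mu> :: "'a::{topological_group_add, t2_space} measure"
    and E U V :: "'a set"
    and \<xi> u :: "'a \<Rightarrow> complex"
  assumes "locally_compact_space (euclidean :: 'a topology)"
    and "left_haar_measure \<mu>"
    and "uniformly_discrete E"
    and "open U" and "0 \<in> U"
    and "\<forall>g1\<in>E. \<forall>g2\<in>E. g1 \<noteq> g2 \<longrightarrow> (\<lambda>y. g1 + y) ` U \<inter> (\<lambda>y. g2 + y) ` U = {}"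
    and "0 \<in> interior V" and "uminus ` V = V" and "V \<in> sets \<mu>" and "compact (closure V)"
    and "{x + y | x y. x \<in> V \<and> y \<in> V} \<subseteq> U"
    and "\<xi> = (\<lambda>x. indicator V x / complex_of_real (L2_norm \<mu> (indicator V)))"
    and "u = (\<lambda>x. L2_inner \<mu> (left_regular x \<xi>) \<xi>)"
  shows "(\<forall>\<phi>\<in>ell2 E. \<forall>x\<in>E. Gamma_map E u \<phi> x = \<phi> x) \<and>
    (Gamma_map E u ` ell2 E \<subseteq> fourier_algebra \<mu> \<and>
     contraction (ell2 E) (ell2_norm E) (fourier_algebra \<mu>) (fourier_norm \<mu>) (Gamma_map E u)) \<and>
    complete_contraction
      (ell2 E) (conjugate_matrix_norm (ell2_row_matrix_norm E))
      (fourier_algebra \<mu>) (fourier_matrix_norm \<mu>) (Gamma_map E u)"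
proof -
  interpret disjoint_translates \<mu> E \<xi>
  proof
    show "left_haar_measure \<mu>" by fact
    show "\<xi> \<in> L2 \<mu>" "L2_norm \<mu> \<xi> = 1"
      using normalized_indicator_window[OF assms(2) _ assms(9,10,12)] assms(7) by auto
    fix h k y assume hk: "h \<in> E" "k \<in> E" "h \<noteq> k"
    \<comment> \<open>Since \<open>0\<close> lies in \<open>V\<close>, each \<open>z = z + 0\<close>
      is a sum of two elements of \<open>V\<close>.\<close>
    have "V \<subseteq> U"
    proof
      fix z assume z: "z \<in> V"
      have "0 \<in> V" using assms(7) interior_subset by blast
      with z have "z + 0 \<in> {x + y | x y. x \<in> V \<and> y \<in> V}" by blast
      then show "z \<in> U" using assms(11) by auto
    qed
    moreover have "g + (- g + y) = y" for g :: 'a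
      by (simp add: add.assoc[symmetric])
    ultimately have "y \<in> (\<lambda>y. g + y) ` U" if "- g + y \<in> V" for g
      using that by (metis image_eqI subsetD)
    \<comment> \<open>Otherwise \<open>y\<close> would lie in both translates \<open>h + U\<close>
      and \<open>k + U\<close>, which are disjoint.\<close>
    then have "\<not> (- h + y \<in> V \<and> - k + y \<in> V)"
      using assms(6) hk by blast
    then show "\<xi> (- h + y) = 0 \<or> \<xi> (- k + y) = 0"
      by (auto simp: assms(12))
  qed
  have u: "u = coefficient \<mu> \<xi> \<xi>"
    by (simp add: assms(13) coefficient_def)
  have "Gamma ` ell2 E \<subseteq> fourier_algebra \<mu>"
    using linear_map_Gamma by (auto simp: linear_map_between_def)
  then show ?thesis
    unfolding u contraction_def complete_contraction_def
    using Gamma_restrict linear_map_Gamma fourier_norm_Gamma_le fourier_matrix_norm_Gamma_le by blast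
qed

end
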